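(* Let $\alpha=a_1/b_1>0$ and $\beta=a_2/b_2\in(0,1]$, where $(a_i,b_i)$ are pairs of coprime integers with $a_i\ge1$, $b_i\ge2$ ($i=1,2$), and let $b$ be the least common multiple of $b_1$ and $b_2$. Let $T>0$, $\Lambda=[0,T]$, $D=\{(t,s)\in\Lambda\times\Lambda:0\le s\le t\le T\}$, $\lambda\in\mathbb{R}$, $y_0^{(0)},\dots,y_0^{(\lceil\alpha\rceil-1)}\in\mathbb{R}$, and let $f:\Lambda\times\mathbb{R}\to\mathbb{R}$ and $g:D\times\mathbb{R}\to\mathbb{R}$ be continuous. Suppose that $f$ and $g$ can be written as $$f(t,y)=\bar f(t^{1/b},y),\qquad g(t,s,y)=\bar g(t^{1/b},s^{1/b},y),$$ where $\bar f$ and $\bar g$ are analytic in a neighborhood of $(0,y_0^{(0)})$ and of $(0,0,y_0^{(0)})$, respectively. Then the (continuous) solution $y$ of $$D_C^{\alpha}y(t)=f(t,y(t))+\lambda\int_0^t(t-s)^{\beta-1}g(t,s,y(s))\,ds,\quad t\in\Lambda,\qquad y^{(k)}(0)=y_0^{(k)},\ k=0,\dots,\lceil\alpha\rceil-1,$$ has, in a neighborhood of the initial point $t=0$ (i.e. for $t\in[0,\omega)$ with some $\omega>0$), a convergent series representation $$y(t)=\psi(t)+\sum_{\mu=\alpha b}^{\infty}\bar y_\mu\,t^{\mu/b},\qquad \psi(t)=\sum_{k=0}^{\lceil\alpha\rceil-1}\frac{t^k}{k!}y_0^{(k)},$$ with real coefficients $\bar y_\mu$ (determined by the data), the sum being over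 integers $\mu\ge\alpha b$.
   Context: $I^{\alpha}h(t)=\frac{1}{\Gamma(\alpha)}\int_0^t(t-s)^{\alpha-1}h(s)\,ds$ is the Riemann–Liouville fractional integral and $D_C^{\alpha}=I^{\lceil\alpha\rceil-\alpha}\partial_t^{\lceil\alpha\rceil}$ the Caputo derivative. A continuous solution of the initial value problem is a continuous $y:\Lambda\to\mathbb{R}$ satisfying the equivalent weakly singular Volterra equation $$y(t)=\psi(t)+I^{\alpha}\big[f(\cdot,y(\cdot))\big](t)+\lambda\, I^{\alpha}\Big[\tau\mapsto\int_0^{\tau}(\tau-s)^{\beta-1}g(\tau,s,y(s))\,ds\Big](t).$$ Note that $\alpha b$ is a positive integer. The representations of $f$ and $g$ through $\bar f,\bar g$ hold whenever both sides are defined. *)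

theory Defs
  imports "HOL-Analysis.Analysis"
begin

text \<open>Riemann--Liouville fractional integral of order \<open>\<alpha>\<close> based at 0. At \<open>s = t\<close> the kernel takes the
  \<open>powr\<close> default value \<open>0 powr _ = 0\<close>, which does not affect the integral.\<close>

definition RL_integral :: "real \<Rightarrow> (real \<Rightarrow> real) \<Rightarrow> real \<Rightarrow> real" where
  "RL_integral \<alpha> h t =
     1 / Gamma \<alpha> * integral {0..t} (\<lambda>s. (t - s) powr (\<alpha> - 1) * h s)"

definition taylor_initial :: "real \<Rightarrow> (nat \<Rightarrow> real) \<Rightarrow> real \<Rightarrow> real" where
  "taylor_initial \<alpha> y0 t = (\<Sum>k<nat \<lceil>\<alpha>\<rceil>. t ^ k / fact k * y0 k)"

text \<open>Continuous solution on \<open>[0, T]\<close> of the initial value problem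
  \<open>D\<^sub>C\<^sup>\<alpha> y(t) = f(t, y(t)) + lam \<integral>\<^sub>0\<^sup>t (t - s)\<^bsup>\<beta> - 1\<^esup> g(t, s, y(s)) ds\<close>,
  \<open>y\<^bsup>(k)\<^esup>(0) = y0 k\<close> for \<open>k < \<lceil>\<alpha>\<rceil>\<close>, where \<open>D\<^sub>C\<^sup>\<alpha>\<close> is the Caputo derivative. By convention this means a
  continuous solution of the equivalent weakly singular Volterra equation.\<close>

definition caputo_ivp_continuous_solution ::
  "real \<Rightarrow> real \<Rightarrow> real \<Rightarrow> real \<Rightarrow> (real \<Rightarrow> real \<Rightarrow> real) \<Rightarrow> (real \<Rightarrow> real \<Rightarrow> real \<Rightarrow> real) \<Rightarrow>
     (nat \<Rightarrow> real) \<Rightarrow> (real \<Rightarrow> real) \<Rightarrow> bool" where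
  "caputo_ivp_continuous_solution \<alpha> \<beta> T lam f g y0 y \<longleftrightarrow>
     continuous_on {0..T} y \<and>
     (\<forall>t\<in>{0..T}. y t =
        taylor_initial \<alpha> y0 t
        + RL_integral \<alpha> (\<lambda>s. f s (y s)) t
        + lam * RL_integral \<alpha>
            (\<lambda>\<tau>. integral {0..\<tau>} (\<lambda>s. (\<tau> - s) powr (\<beta> - 1) * g \<tau> s (y s))) t)"

text \<open>Real analyticity in two and three variables: near every point of the set the function is the
  sum of a (necessarily absolutely) convergent power series centred at that point.\<close>

definition real_analytic2_on :: "(real \<times> real \<Rightarrow> real) \<Rightarrow> (real \<times> real) set \<Rightarrow> bool" where
  "real_analytic2_on F U \<longleftrightarrow>
     (\<forall>(x0, y0)\<in>U. \<exists>r>0. \<exists>c :: nat \<Rightarrow> nat \<Rightarrow> real. \<forall>x y.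
        \<bar>x - x0\<bar> < r \<longrightarrow> \<bar>y - y0\<bar> < r \<longrightarrow>
        ((\<lambda>(i, j). c i j * (x - x0) ^ i * (y - y0) ^ j) has_sum F (x, y)) UNIV)"

definition real_analytic3_on ::
  "(real \<times> real \<times> real \<Rightarrow> real) \<Rightarrow> (real \<times> real \<times> real) set \<Rightarrow> bool" where
  "real_analytic3_on F U \<longleftrightarrow>
     (\<forall>(x0, y0, z0)\<in>U. \<exists>r>0. \<exists>c :: nat \<Rightarrow> nat \<Rightarrow> nat \<Rightarrow> real. \<forall>x y z.
        \<bar>x - x0\<bar> < r \<longrightarrow> \<bar>y - y0\<bar> < r \<longrightarrow> \<bar>z - z0\<bar> < r \<longrightarrow>
        ((\<lambda>(i, j, k). c i j k * (x - x0) ^ i * (y - y0) ^ j * (z - z0) ^ k)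
           has_sum F (x, y, z)) UNIV)"

end

theory Submission
  imports Defs "HOL-Complex_Analysis.Cauchy_Integral_Formula"
begin

text \<open>In the variable \<open>x = t\<^bsup>1/b\<^esup>\<close>, and after substituting away the weakly singular kernels, the Volterra
  equation for \<open>u = y - y\<^sub>0\<close> becomes \<open>u(x) = P(x) + x\<^sup>m K[u](x)\<close>, where \<open>P\<close> is a polynomial with
  \<open>P(0) = 0\<close> and \<open>K[u](x)\<close> averages a convergent power series in \<open>(a x, c x, u(c x))\<close> over
  parameters \<open>a, c \<in> [0, 1]\<close>. This makes sense for complex \<open>x\<close>: on a small disc the right-hand side is
  a contraction, and it preserves uniform limits of polynomials, so the Picard iterates converge to a
  holomorphic \<open>W\<close>. The same estimate on the real segment \<open>[0, r]\<close> shows that the iterates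
  also converge to every continuous solution there. Hence every solution equals \<open>P + x\<^sup>m K[W]\<close> near 0, and
  the coefficients are the real parts of the Taylor coefficients of \<open>K[W]\<close>.\<close>

subsection \<open>Uniform limits of polynomials on a disc\<close>

text \<open>The integer values of \<alpha> b and \<beta> b are what allow complex arguments: the
  factors t^\<alpha> and t^\<beta> left behind by the kernels become x^m and x^n. The function class
  is chosen to suit averaging. A polynomial averaged over the parameters is again a polynomial by
  linearity, so holomorphy of K[U] follows by approximation, without differentiating under an
  integral sign. Membership constrains a function on the closed disc only.

  A solution is merely continuous and lives on a real interval, and away from the initial point f
  and g are merely continuous, so analyticity has to be imported from iterates built out of the
  power series alone. The real and the complex picture share one operator because K[U](x) reads U
  only on the segment from 0 to x. As W does not refer to y, its coefficients serve all solutions at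
  once. Expanding K[W] instead of W separates the Taylor polynomial from the fractional part, which
  then starts at the exponent m/b.\<close>

definition disc_algebra :: "real \<Rightarrow> (complex \<Rightarrow> complex) set" where
  "disc_algebra r = {\<phi>. \<forall>\<epsilon>>0. \<exists>p. \<forall>z\<in>cball 0 r. norm (\<phi> z - poly p z) \<le> \<epsilon>}"

lemma disc_algebraI:
  "(\<And>\<epsilon>. \<epsilon> > 0 \<Longrightarrow> \<exists>p. \<forall>z\<in>cball 0 r. norm (\<phi> z - poly p z) \<le> \<epsilon>) \<Longrightarrow> \<phi> \<in> disc_algebra r"
  by (simp add: disc_algebra_def)

lemma disc_algebraE:
  assumes "\<phi> \<in> disc_algebra r" "\<epsilon> > 0"
  obtains p where "\<And>z. z \<in> cball 0 r \<Longrightarrow> norm (\<phi> z - poly p z) \<le> \<epsilon>"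
  using assms unfolding disc_algebra_def by blast

lemma poly_in_disc_algebra: "poly p \<in> disc_algebra r"
  by (rule disc_algebraI, rule exI[of _ p]) auto

lemma disc_algebra_limit:
  assumes "\<And>\<epsilon>. \<epsilon> > 0 \<Longrightarrow> \<exists>\<psi>\<in>disc_algebra r. \<forall>z\<in>cball 0 r. norm (\<phi> z - \<psi> z) \<le> \<epsilon>"
  shows "\<phi> \<in> disc_algebra r"
proof (rule disc_algebraI)
  fix \<epsilon> :: real assume "\<epsilon> > 0"
  then obtain \<psi> where \<psi>: "\<psi> \<in> disc_algebra r" "\<forall>z\<in>cball 0 r. norm (\<phi> z - \<psi> z) \<le> \<epsilon> / 2"
    using assms[of "\<epsilon> / 2"] by auto
  obtain p where p: "\<And>z. z \<in> cball 0 r \<Longrightarrow> norm (\<psi> z - poly p z) \<le> \<epsilon> / 2"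
    using disc_algebraE[OF \<psi>(1), of "\<epsilon> / 2"] \<open>\<epsilon> > 0\<close> by auto
  have "norm (\<phi> z - poly p z) \<le> \<epsilon>" if "z \<in> cball 0 r" for z
    using norm_triangle_ineq[of "\<phi> z - \<psi> z" "\<psi> z - poly p z"] \<psi>(2) p that by force
  thus "\<exists>p. \<forall>z\<in>cball 0 r. norm (\<phi> z - poly p z) \<le> \<epsilon>" by blast
qed

lemma disc_algebra_add:
  assumes "\<phi> \<in> disc_algebra r" "\<psi> \<in> disc_algebra r"
  shows "(\<lambda>z. \<phi> z + \<psi> z) \<in> disc_algebra r"
proof (rule disc_algebraI)
  fix \<epsilon> :: real assume "\<epsilon> > 0"
  hence *: "\<epsilon> / 2 > 0" by simp
  obtain p where p: "\<And>z. z \<in> cball 0 r \<Longrightarrow> norm (\<phi> z - poly p z) \<le> \<epsilon> / 2"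
    using disc_algebraE[OF assms(1) *] by blast
  obtain q where q: "\<And>z. z \<in> cball 0 r \<Longrightarrow> norm (\<psi> z - poly q z) \<le> \<epsilon> / 2"
    using disc_algebraE[OF assms(2) *] by blast
  have "norm (\<phi> z + \<psi> z - poly (p + q) z) \<le> \<epsilon>" if "z \<in> cball 0 r" for z
    using norm_triangle_ineq[of "\<phi> z - poly p z" "\<psi> z - poly q z"] p[OF that] q[OF that]
    by (simp add: algebra_simps)
  thus "\<exists>p. \<forall>z\<in>cball 0 r. norm (\<phi> z + \<psi> z - poly p z) \<le> \<epsilon>" by blast
qed

text \<open>A polynomial is bounded on the closed disc, so an approximation within
  \<open>\<epsilon> / B\<close> suffices. The factors met below are constants and monomials in
  x.\<close>

lemma disc_algebra_poly_mult:
  assumes "\<phi> \<in> disc_algebra r"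
  shows "(\<lambda>z. poly q z * \<phi> z) \<in> disc_algebra r"
proof (rule disc_algebraI)
  fix \<epsilon> :: real assume "\<epsilon> > 0"
  have "compact (poly q ` cball 0 r)"
    by (intro compact_continuous_image continuous_intros) auto
  then obtain B where B: "B > 0" "\<And>z. z \<in> cball 0 r \<Longrightarrow> norm (poly q z) \<le> B"
    using compact_imp_bounded bounded_pos by (metis (no_types, lifting) image_eqI)
  obtain p where p: "\<And>z. z \<in> cball 0 r \<Longrightarrow> norm (\<phi> z - poly p z) \<le> \<epsilon> / B"
    using disc_algebraE[OF assms, of "\<epsilon> / B"] B(1) \<open>\<epsilon> > 0\<close> by auto
  have "norm (poly q z * \<phi> z - poly (q * p) z) \<le> \<epsilon>" if "z \<in> cball 0 r" for z
  proof -
    have "norm (poly q z * \<phi> z - poly (q * p) z) = norm (poly q z) * norm (\<phi> z - poly p z)"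
      by (simp add: norm_mult[symmetric] algebra_simps)
    also have "\<dots> \<le> B * (\<epsilon> / B)"
      using B p that by (intro mult_mono) auto
    finally show ?thesis using B by simp
  qed
  thus "\<exists>p. \<forall>z\<in>cball 0 r. norm (poly q z * \<phi> z - poly p z) \<le> \<epsilon>" by blast
qed

text \<open>Tolerances \<open>1 / (n + 1)\<close> give a sequence of polynomials converging
  uniformly, and Weierstrass applies. Continuity up to the boundary lets the closed disc be a domain
  of the contraction estimates; holomorphy inside yields the final Taylor series.\<close>

lemma disc_algebra_continuous_holomorphic:
  assumes "\<phi> \<in> disc_algebra r"
  shows "continuous_on (cball 0 r) \<phi>" "\<phi> holomorphic_on ball 0 r"
proof -
  have "\<exists>p. \<forall>z\<in>cball 0 r. norm (\<phi> z - poly p z) \<le> 1 / (real n + 1)" for n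
    using assms by (simp add: disc_algebra_def)
  then obtain P where P: "\<And>n z. z \<in> cball 0 r \<Longrightarrow> norm (\<phi> z - poly (P n) z) \<le> 1 / (real n + 1)"
    by metis
  have lim: "uniform_limit (cball 0 r) (\<lambda>n. poly (P n)) \<phi> sequentially"
  proof (rule uniform_limitI)
    fix e :: real assume "e > 0"
    then obtain N :: nat where N: "1 / (real N + 1) < e"
      by (metis nat_approx_posE of_nat_Suc add.commute)
    have "dist (poly (P n) z) (\<phi> z) < e" if "n \<ge> N" "z \<in> cball 0 r" for n z
    proof -
      have "dist (poly (P n) z) (\<phi> z) \<le> 1 / (real n + 1)"
        using P[OF that(2), of n] by (simp add: dist_norm norm_minus_commute)
      also have "\<dots> \<le> 1 / (real N + 1)" using that by (intro divide_left_mono) auto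
      finally show ?thesis using N by simp
    qed
    thus "\<forall>\<^sub>F n in sequentially. \<forall>z\<in>cball 0 r. dist (poly (P n) z) (\<phi> z) < e"
      using eventually_sequentially by blast
  qed
  show "continuous_on (cball 0 r) \<phi>" "\<phi> holomorphic_on ball 0 r"
    by (rule holomorphic_uniform_limit[OF _ lim];
        auto intro!: always_eventually continuous_intros holomorphic_intros)+
qed

section \<open>Elementary bounds for averages and for differences of powers\<close>

lemma norm_integral_le_if_measure_le_1:
  fixes f :: "'e::euclidean_space \<Rightarrow> complex"
  assumes "continuous_on (cbox lo hi) f" "measure lborel (cbox lo hi) \<le> 1" "0 \<le> B"
    and "\<And>\<omega>. \<omega> \<in> cbox lo hi \<Longrightarrow> norm (f \<omega>) \<le> B"
  shows "norm (integral (cbox lo hi) f) \<le> B"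
proof -
  have "norm (integral (cbox lo hi) f) \<le> B * measure lborel (cbox lo hi)"
    using assms by (intro has_integral_bound[of B f]) (auto simp: integrable_continuous integrable_integral)
  also have "\<dots> \<le> B * 1" using assms by (intro mult_left_mono) auto
  finally show ?thesis by simp
qed

text \<open>Scaling to the unit disc gives the factor k, and k \<le> 2^k trades it for a doubled
  radius. A Lipschitz estimate thus costs only a larger radius in the majorant, with no derivative
  series.\<close>

lemma norm_power_diff_le:
  fixes u v :: complex
  assumes "norm u \<le> r" "norm v \<le> r" "r > 0"
  shows "norm (u ^ k - v ^ k) \<le> (2 * r) ^ k / r * norm (u - v)"
proof -
  have "norm ((u / of_real r) ^ k - (v / of_real r) ^ k) \<le> k * norm (u / of_real r - v / of_real r)"
    using assms by (intro norm_power_diff) (auto simp: norm_divide)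
  also have "(u / of_real r) ^ k - (v / of_real r) ^ k = (u ^ k - v ^ k) / of_real (r ^ k)"
    by (simp add: power_divide diff_divide_distrib)
  also have "u / of_real r - v / of_real r = (u - v) / of_real r"
    by (simp add: diff_divide_distrib)
  finally have "norm (u ^ k - v ^ k) \<le> k * r ^ k / r * norm (u - v)"
    using assms by (simp add: norm_divide field_simps norm_power)
  also have "\<dots> \<le> (2 * r) ^ k / r * norm (u - v)"
  proof -
    have "real k \<le> 2 ^ k" by (metis less_imp_le of_nat_less_two_power)
    thus ?thesis using assms
      by (intro mult_right_mono divide_right_mono) (auto simp: power_mult_distrib)
  qed
  finally show ?thesis .
qed

subsection \<open>Integral operators with power series integrand\<close>

text \<open>The coefficients are summable at radius \<open>4 * R\<close>, so that \<open>H\<close> is Lipschitz in its last argument up to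
  radius \<open>2 * R\<close>; this leaves room to replace a function bounded by \<open>R\<close> by a polynomial approximation.\<close>

locale power_series_operator =
  fixes C :: "'i \<Rightarrow> complex" and e1 e2 e3 :: "'i \<Rightarrow> nat" and R :: real
    and w a c :: "'e::euclidean_space \<Rightarrow> real" and lo hi :: 'e
  assumes R: "R > 0"
    and summable: "(\<lambda>n. norm (C n) * (4 * R) ^ (e1 n + e2 n + e3 n)) summable_on UNIV"
    and cont: "continuous_on (cbox lo hi) w" "continuous_on (cbox lo hi) a"
      "continuous_on (cbox lo hi) c"
    and unit: "\<And>\<omega>. \<omega> \<in> cbox lo hi \<Longrightarrow> w \<omega> \<in> {0..1} \<and> a \<omega> \<in> {0..1} \<and> c \<omega> \<in> {0..1}"
    and measure_le: "measure lborel (cbox lo hi) \<le> 1"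
begin

text \<open>Exponents are functions of an abstract index so that one series covers both data: index
  pairs with \<open>e1 = 0\<close> for f, index triples for g.\<close>

definition H :: "complex \<Rightarrow> complex \<Rightarrow> complex \<Rightarrow> complex" where
  "H x1 x2 u = (\<Sum>\<^sub>\<infinity>n. C n * x1 ^ e1 n * x2 ^ e2 n * u ^ e3 n)"

text \<open>Both integrals of the transformed equation have this shape, over [0,1] for f and over
  the unit square for g. The weight \<open>w\<close> holds the power that the inner kernel leaves
  behind.\<close>

definition K :: "(complex \<Rightarrow> complex) \<Rightarrow> complex \<Rightarrow> complex" where
  "K U x = integral (cbox lo hi)
     (\<lambda>\<omega>. of_real (w \<omega>) * H (of_real (a \<omega>) * x) (of_real (c \<omega>) * x) (U (of_real (c \<omega>) * x)))"

text \<open>The majorant series at radius \<open>4 * R\<close> in each variable. It bounds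
  \<open>H\<close> and, divided by \<open>2 * R\<close>, is its Lipschitz constant.\<close>

definition M :: real where
  "M = (\<Sum>\<^sub>\<infinity>n. norm (C n) * (4 * R) ^ (e1 n + e2 n + e3 n))"

section \<open>Majorant bounds and uniform approximation of the power series\<close>

lemma M_nonneg: "M \<ge> 0"
  unfolding M_def using R by (intro infsum_nonneg) auto

lemma norm_term_le:
  assumes "norm x1 \<le> 4 * R" "norm x2 \<le> 4 * R" "norm u \<le> 4 * R"
  shows "norm (C n * x1 ^ e1 n * x2 ^ e2 n * u ^ e3 n) \<le> norm (C n) * (4 * R) ^ (e1 n + e2 n + e3 n)"
  unfolding power_add norm_mult norm_power mult.assoc using assms R
  by (intro mult_left_mono mult_mono power_mono) auto

lemma abs_summable_terms:
  assumes "norm x1 \<le> 4 * R" "norm x2 \<le> 4 * R" "norm u \<le> 4 * R"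
  shows "(\<lambda>n. norm (C n * x1 ^ e1 n * x2 ^ e2 n * u ^ e3 n)) summable_on UNIV"
  using norm_term_le[OF assms] by (intro Infinite_Sum.abs_summable_on_comparison_test'[OF summable]) auto

lemma norm_H_le:
  assumes "norm x1 \<le> 4 * R" "norm x2 \<le> 4 * R" "norm u \<le> 4 * R"
  shows "norm (H x1 x2 u) \<le> M"
  unfolding H_def M_def using norm_term_le[OF assms] 
  by (intro norm_infsum_le[OF has_sum_infsum has_sum_infsum] summable
      abs_summable_summable[OF abs_summable_terms[OF assms]]) auto

lemma H_lipschitz:
  assumes "norm x1 \<le> 4 * R" "norm x2 \<le> 4 * R" "norm u \<le> 2 * R" "norm v \<le> 2 * R"
  shows "norm (H x1 x2 u - H x1 x2 v) \<le> M / (2 * R) * norm (u - v)"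
proof -
  let ?T = "\<lambda>u n. C n * x1 ^ e1 n * x2 ^ e2 n * u ^ e3 n"
  have s: "?T u summable_on UNIV" "?T v summable_on UNIV"
    using assms R by (intro abs_summable_summable[OF abs_summable_terms]; simp)+
  have "H x1 x2 u - H x1 x2 v = (\<Sum>\<^sub>\<infinity>n. ?T u n + - ?T v n)"
    unfolding H_def using s by (subst infsum_add) (auto simp: infsum_uminus summable_on_uminus)
  also have "norm \<dots> \<le> M * (1 / (2 * R) * norm (u - v))"
  proof (rule norm_infsum_le[OF has_sum_infsum])
    show "(\<lambda>n. ?T u n + - ?T v n) summable_on UNIV"
      using s by (intro summable_on_add) (auto simp: summable_on_uminus)
    show "((\<lambda>n. norm (C n) * (4 * R) ^ (e1 n + e2 n + e3 n) * (1 / (2 * R) * norm (u - v))) has_sum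
        M * (1 / (2 * R) * norm (u - v))) UNIV"
      unfolding M_def by (intro has_sum_cmult_left has_sum_infsum summable)
    fix n
    have "norm (?T u n + - ?T v n) =
        norm (C n) * (norm x1 ^ e1 n * (norm x2 ^ e2 n * norm (u ^ e3 n - v ^ e3 n)))"
      by (simp add: norm_mult[symmetric] norm_power[symmetric] algebra_simps)
    also have "\<dots> \<le> norm (C n) * ((4 * R) ^ e1 n * ((4 * R) ^ e2 n *
        ((2 * (2 * R)) ^ e3 n / (2 * R) * norm (u - v))))"
      \<comment> \<open>The power estimate is used at radius \<open>2 * R\<close>; its doubled base
        is exactly the radius \<open>4 * R\<close> of the majorant.\<close>
      using assms R by (intro mult_left_mono mult_mono power_mono norm_power_diff_le) auto
    also have "\<dots> = norm (C n) * (4 * R) ^ (e1 n + e2 n + e3 n) * (1 / (2 * R) * norm (u - v))"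
      by (simp add: power_add)
    finally show "norm (?T u n + - ?T v n) \<le>
        norm (C n) * (4 * R) ^ (e1 n + e2 n + e3 n) * (1 / (2 * R) * norm (u - v))" .
  qed
  finally show ?thesis by simp
qed

abbreviation "polydisc \<equiv> cball (0::complex) (4 * R) \<times> cball (0::complex) (4 * R) \<times> cball (0::complex) (4 * R)"

text \<open>The M-test along finite index sets. It gives continuity of \<open>H\<close> and its
  approximation by polynomials in three variables.\<close>

lemma H_uniform_limit:
  "uniform_limit polydisc (\<lambda>F (x1, x2, u). \<Sum>n\<in>F. C n * x1 ^ e1 n * x2 ^ e2 n * u ^ e3 n)
     (\<lambda>(x1, x2, u). H x1 x2 u) (finite_subsets_at_top UNIV)"
proof -
  have "uniform_limit polydisc (\<lambda>F z. \<Sum>n\<in>F. C n * fst z ^ e1 n * fst (snd z) ^ e2 n * snd (snd z) ^ e3 n)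
     (\<lambda>z. \<Sum>\<^sub>\<infinity>n. C n * fst z ^ e1 n * fst (snd z) ^ e2 n * snd (snd z) ^ e3 n) (finite_subsets_at_top UNIV)"
    by (rule Weierstrass_m_test_general[OF _ summable], rule norm_term_le) auto
  thus ?thesis by (simp add: H_def case_prod_unfold)
qed

lemma H_continuous: "continuous_on polydisc (\<lambda>(x1, x2, u). H x1 x2 u)"
  by (rule uniform_limit_theorem[OF _ H_uniform_limit])
     (auto intro!: always_eventually continuous_intros simp: case_prod_unfold)

lemma H_approx:
  assumes "\<epsilon> > 0"
  obtains F where "finite F"
    "\<And>x1 x2 u. norm x1 \<le> 4 * R \<Longrightarrow> norm x2 \<le> 4 * R \<Longrightarrow> norm u \<le> 4 * R \<Longrightarrow>
       norm (H x1 x2 u - (\<Sum>n\<in>F. C n * x1 ^ e1 n * x2 ^ e2 n * u ^ e3 n)) \<le> \<epsilon>"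
proof -
  have ev: "\<forall>\<^sub>F F in finite_subsets_at_top UNIV. \<forall>z\<in>polydisc.
      dist ((\<lambda>(x1, x2, u). \<Sum>n\<in>F. C n * x1 ^ e1 n * x2 ^ e2 n * u ^ e3 n) z)
        ((\<lambda>(x1, x2, u). H x1 x2 u) z) < \<epsilon>"
    by (rule uniform_limitD[OF H_uniform_limit assms])
  then obtain F where "finite F" "\<And>z. z \<in> polydisc \<Longrightarrow>
      dist ((\<lambda>(x1, x2, u). \<Sum>n\<in>F. C n * x1 ^ e1 n * x2 ^ e2 n * u ^ e3 n) z)
        ((\<lambda>(x1, x2, u). H x1 x2 u) z) < \<epsilon>"
    by (metis (no_types, lifting) eventually_finite_subsets_at_top subset_UNIV order_refl)
  thus thesis
    by (intro that[of F]) (force simp: dist_norm norm_minus_commute)+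
qed

section \<open>Averages over the parameter box: bounds, Lipschitz dependence, stability of the disc
  algebra\<close>

lemma continuous_on_integrand:
  assumes star: "\<And>x s. x \<in> S \<Longrightarrow> s \<in> {0..1} \<Longrightarrow> of_real s * x \<in> S" and "S \<subseteq> cball 0 (4 * R)"
    and "continuous_on S U" "\<And>x. x \<in> S \<Longrightarrow> norm (U x) \<le> 4 * R" and "x \<in> S"
  shows "continuous_on (cbox lo hi)
    (\<lambda>\<omega>. of_real (w \<omega>) * H (of_real (a \<omega>) * x) (of_real (c \<omega>) * x) (U (of_real (c \<omega>) * x)))"
proof -
  have inS: "of_real (a \<omega>) * x \<in> S" "of_real (c \<omega>) * x \<in> S" if "\<omega> \<in> cbox lo hi" for \<omega>
    using unit[OF that] star \<open>x \<in> S\<close> by auto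
  have "continuous_on (cbox lo hi) (\<lambda>\<omega>. U (of_real (c \<omega>) * x))"
    using inS by (intro continuous_on_compose2[OF assms(3)] continuous_intros cont) auto
  hence "continuous_on (cbox lo hi)
      (\<lambda>\<omega>. (of_real (a \<omega>) * x, of_real (c \<omega>) * x, U (of_real (c \<omega>) * x)))"
    by (intro continuous_intros cont)
  moreover have "(of_real (a \<omega>) * x, of_real (c \<omega>) * x, U (of_real (c \<omega>) * x)) \<in> polydisc"
    if "\<omega> \<in> cbox lo hi" for \<omega>
    using inS[OF that] assms(2,4) by (auto simp: subset_iff)
  ultimately have "continuous_on (cbox lo hi)
      (\<lambda>\<omega>. (\<lambda>(x1, x2, u). H x1 x2 u) (of_real (a \<omega>) * x, of_real (c \<omega>) * x, U (of_real (c \<omega>) * x)))"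
    by (intro continuous_on_compose2[OF H_continuous]) auto
  thus ?thesis by (auto intro!: continuous_intros cont)
qed

lemma norm_weight_mult_le:
  fixes z :: complex
  assumes "\<omega> \<in> cbox lo hi" "norm z \<le> B"
  shows "norm (of_real (w \<omega>) * z) \<le> B"
proof -
  have "\<bar>w \<omega>\<bar> * norm z \<le> 1 * norm z" using unit[OF assms(1)] by (intro mult_right_mono) auto
  thus ?thesis using assms(2) by (simp add: norm_mult)
qed

lemma norm_K_le:
  assumes star: "\<And>x s. x \<in> S \<Longrightarrow> s \<in> {0..1} \<Longrightarrow> of_real s * x \<in> S" and S: "S \<subseteq> cball 0 (4 * R)"
    and U: "continuous_on S U" "\<And>x. x \<in> S \<Longrightarrow> norm (U x) \<le> 4 * R" and "x \<in> S"
  shows "norm (K U x) \<le> M"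
  unfolding K_def
proof (rule norm_integral_le_if_measure_le_1[OF continuous_on_integrand[OF assms] measure_le M_nonneg])
  fix \<omega> assume \<omega>: "\<omega> \<in> cbox lo hi"
  have "of_real (a \<omega>) * x \<in> S" "of_real (c \<omega>) * x \<in> S" using unit[OF \<omega>] star \<open>x \<in> S\<close> by auto
  thus "norm (of_real (w \<omega>) * H (of_real (a \<omega>) * x) (of_real (c \<omega>) * x) (U (of_real (c \<omega>) * x))) \<le> M"
    using S U(2) by (intro norm_weight_mult_le[OF \<omega>] norm_H_le) force+
qed

lemma K_lipschitz:
  assumes star: "\<And>x s. x \<in> S \<Longrightarrow> s \<in> {0..1} \<Longrightarrow> of_real s * x \<in> S" and S: "S \<subseteq> cball 0 (4 * R)"
    and U: "continuous_on S U" "\<And>x. x \<in> S \<Longrightarrow> norm (U x) \<le> 2 * R"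
    and V: "continuous_on S V" "\<And>x. x \<in> S \<Longrightarrow> norm (V x) \<le> 2 * R"
    and \<delta>: "\<And>x. x \<in> S \<Longrightarrow> norm (U x - V x) \<le> \<delta>" and "x \<in> S"
  shows "norm (K U x - K V x) \<le> M / (2 * R) * \<delta>"
proof -
  let ?I = "\<lambda>U \<omega>. of_real (w \<omega>) * H (of_real (a \<omega>) * x) (of_real (c \<omega>) * x) (U (of_real (c \<omega>) * x))"
  have cU: "continuous_on (cbox lo hi) (?I U)" and cV: "continuous_on (cbox lo hi) (?I V)"
    using U(2) V(2) R by (intro continuous_on_integrand[OF star S]; fastforce intro: U(1) V(1) \<open>x \<in> S\<close>)+
  have "\<delta> \<ge> 0" using \<delta>[OF \<open>x \<in> S\<close>] norm_ge_zero order_trans by blast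
  have eq: "K U x - K V x = integral (cbox lo hi) (\<lambda>\<omega>. ?I U \<omega> - ?I V \<omega>)"
    unfolding K_def by (intro integral_diff[symmetric] integrable_continuous cU cV)
  show ?thesis
    unfolding eq
  proof (rule norm_integral_le_if_measure_le_1[OF _ measure_le])
    show "continuous_on (cbox lo hi) (\<lambda>\<omega>. ?I U \<omega> - ?I V \<omega>)" by (intro continuous_intros cU cV)
    show "0 \<le> M / (2 * R) * \<delta>" using M_nonneg R \<open>\<delta> \<ge> 0\<close> by simp
    fix \<omega> assume \<omega>: "\<omega> \<in> cbox lo hi"
    have inS: "of_real (a \<omega>) * x \<in> S" "of_real (c \<omega>) * x \<in> S" using unit[OF \<omega>] star \<open>x \<in> S\<close> by auto
    let ?a = "of_real (a \<omega>) * x" and ?c = "of_real (c \<omega>) * x"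
    have "norm (H ?a ?c (U ?c) - H ?a ?c (V ?c)) \<le> M / (2 * R) * norm (U ?c - V ?c)"
      using inS S U(2) V(2) by (intro H_lipschitz) force+
    also have "\<dots> \<le> M / (2 * R) * \<delta>"
      using \<delta> inS M_nonneg R by (intro mult_left_mono) auto
    finally show "norm (?I U \<omega> - ?I V \<omega>) \<le> M / (2 * R) * \<delta>"
      unfolding right_diff_distrib[symmetric] by (rule norm_weight_mult_le[OF \<omega>])
  qed
qed

text \<open>Horner's scheme under the integral. The weight is generalised because splitting off the
  constant coefficient turns \<open>v\<close> into \<open>v * c\<close>.\<close>

lemma integral_poly_is_poly:
  fixes p :: "complex poly"
  shows
  "continuous_on (cbox lo hi) v \<Longrightarrow>
     \<exists>q. \<forall>z. integral (cbox lo hi) (\<lambda>\<omega>. of_real (v \<omega>) * poly p (of_real (c \<omega>) * z)) = poly q z"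
proof (induction p arbitrary: v)
  case 0
  show ?case by (rule exI[of _ 0]) simp
next
  case (pCons k p)
  obtain q where q: "\<And>z. integral (cbox lo hi)
      (\<lambda>\<omega>. of_real (v \<omega> * c \<omega>) * poly p (of_real (c \<omega>) * z)) = poly q z"
    using pCons.IH[of "\<lambda>\<omega>. v \<omega> * c \<omega>"] pCons.prems cont by (auto intro: continuous_intros)
  have "integral (cbox lo hi) (\<lambda>\<omega>. of_real (v \<omega>) * poly (pCons k p) (of_real (c \<omega>) * z)) =
      poly (pCons (integral (cbox lo hi) (\<lambda>\<omega>. of_real (v \<omega>) * k)) q) z" for z
  proof -
    have "integral (cbox lo hi) (\<lambda>\<omega>. of_real (v \<omega>) * poly (pCons k p) (of_real (c \<omega>) * z)) =
        integral (cbox lo hi) (\<lambda>\<omega>. of_real (v \<omega>) * k +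
          z * (of_real (v \<omega> * c \<omega>) * poly p (of_real (c \<omega>) * z)))"
      by (simp add: algebra_simps)
    also have "\<dots> = integral (cbox lo hi) (\<lambda>\<omega>. of_real (v \<omega>) * k) + z *
        integral (cbox lo hi) (\<lambda>\<omega>. of_real (v \<omega> * c \<omega>) * poly p (of_real (c \<omega>) * z))"
      using pCons.prems cont
      by (subst integral_add) (auto intro!: integrable_continuous continuous_intros)
    finally show ?thesis by (simp only: q poly_pCons)
  qed
  thus ?case by blast
qed

lemma K_disc_algebra:
  assumes U: "U \<in> disc_algebra r" "\<And>x. x \<in> cball 0 r \<Longrightarrow> norm (U x) \<le> R" and r: "r \<le> 4 * R"
  shows "K U \<in> disc_algebra r"
proof (rule disc_algebraI)
  fix \<epsilon> :: real assume "\<epsilon> > 0"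
  define L where "L = M / (2 * R)"
  have "L \<ge> 0" using M_nonneg R by (simp add: L_def)
  \<comment> \<open>The bound R keeps \<open>p\<close> below \<open>2 * R\<close>, inside the
    Lipschitz range; the other bound makes replacing \<open>U\<close> by \<open>p\<close> cost at
    most \<open>\<epsilon> / 2\<close>. Using \<open>L + 1\<close> avoids a zero denominator. The
    other \<open>\<epsilon> / 2\<close> pays for truncating the series.\<close>
  obtain p where p: "\<And>z. z \<in> cball 0 r \<Longrightarrow> norm (U z - poly p z) \<le> min R (\<epsilon> / (2 * (L + 1)))"
    using disc_algebraE[OF U(1), of "min R (\<epsilon> / (2 * (L + 1)))"] R \<open>\<epsilon> > 0\<close> \<open>L \<ge> 0\<close> by auto
  obtain F where F: "finite F"
    "\<And>x1 x2 u. norm x1 \<le> 4 * R \<Longrightarrow> norm x2 \<le> 4 * R \<Longrightarrow> norm u \<le> 4 * R \<Longrightarrow>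
       norm (H x1 x2 u - (\<Sum>n\<in>F. C n * x1 ^ e1 n * x2 ^ e2 n * u ^ e3 n)) \<le> \<epsilon> / 2"
    using H_approx[of "\<epsilon> / 2"] \<open>\<epsilon> > 0\<close> by auto
  have star: "of_real s * x \<in> cball 0 r" if "x \<in> cball 0 r" "s \<in> {0..1}" for x :: complex and s
    using that mult_mono[of "\<bar>s\<bar>" 1 "norm x" r] by (auto simp: norm_mult)
  have sub: "cball 0 r \<subseteq> cball (0::complex) (4 * R)" using r by auto
  have pR: "norm (poly p z) \<le> 2 * R" if "z \<in> cball 0 r" for z
    using norm_triangle_ineq4[of "U z" "U z - poly p z"] p[OF that] U(2)[OF that] by simp
  define J where "J = (\<lambda>z \<omega>. \<Sum>n\<in>F. C n * (of_real (a \<omega>) * z) ^ e1 n * (of_real (c \<omega>) * z) ^ e2 n *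
      poly p (of_real (c \<omega>) * z) ^ e3 n)"
  have cont_J: "continuous_on (cbox lo hi) (J z)" for z
    unfolding J_def by (intro continuous_intros cont)
  \<comment> \<open>In each term of the truncated series \<open>z ^ e1 n\<close> leaves the integral
    and \<open>a ^ e1 n\<close> joins the weight; what remains is a polynomial evaluated at
    \<open>c z\<close>.\<close>
  have "\<exists>q. \<forall>z. integral (cbox lo hi) (\<lambda>\<omega>. of_real (w \<omega> * a \<omega> ^ e1 n) *
      poly (monom 1 (e2 n) * p ^ e3 n) (of_real (c \<omega>) * z)) = poly q z" for n
    by (intro integral_poly_is_poly continuous_intros cont)
  then obtain q where q: "\<And>n z. integral (cbox lo hi) (\<lambda>\<omega>. of_real (w \<omega> * a \<omega> ^ e1 n) *
      poly (monom 1 (e2 n) * p ^ e3 n) (of_real (c \<omega>) * z)) = poly (q n) z"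
    by metis
  define Q where "Q = (\<Sum>n\<in>F. smult (C n) (monom 1 (e1 n) * q n))"
  have int_J: "integral (cbox lo hi) (\<lambda>\<omega>. of_real (w \<omega>) * J z \<omega>) = poly Q z" for z
  proof -
    have "integral (cbox lo hi) (\<lambda>\<omega>. of_real (w \<omega>) * J z \<omega>) =
        integral (cbox lo hi) (\<lambda>\<omega>. \<Sum>n\<in>F. (C n * z ^ e1 n) * (of_real (w \<omega> * a \<omega> ^ e1 n) *
          poly (monom 1 (e2 n) * p ^ e3 n) (of_real (c \<omega>) * z)))"
      by (simp add: J_def sum_distrib_left poly_monom power_mult_distrib mult_ac)
    also have "\<dots> = (\<Sum>n\<in>F. (C n * z ^ e1 n) * integral (cbox lo hi) (\<lambda>\<omega>. of_real (w \<omega> * a \<omega> ^ e1 n) *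
          poly (monom 1 (e2 n) * p ^ e3 n) (of_real (c \<omega>) * z)))"
      using F(1) by (subst integral_sum) (auto intro!: integrable_continuous continuous_intros cont)
    also have "\<dots> = poly Q z"
      unfolding q by (simp add: Q_def poly_sum poly_monom mult_ac)
    finally show ?thesis .
  qed
  have "norm (K U z - poly Q z) \<le> \<epsilon>" if z: "z \<in> cball 0 r" for z
  proof -
    have 1: "norm (K U z - K (poly p) z) \<le> L * (\<epsilon> / (2 * (L + 1)))"
      unfolding L_def
    proof (rule K_lipschitz[OF star sub])
      show "norm (U x) \<le> 2 * R" if "x \<in> cball 0 r" for x using U(2)[OF that] R by simp
      show "norm (U x - poly p x) \<le> \<epsilon> / (2 * (M / (2 * R) + 1))" if "x \<in> cball 0 r" for x
        using p[OF that] by (simp add: L_def)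
    qed (use z disc_algebra_continuous_holomorphic(1)[OF U(1)] pR in \<open>auto intro!: continuous_intros\<close>)
    have 2: "L * (\<epsilon> / (2 * (L + 1))) \<le> \<epsilon> / 2"
      using \<open>L \<ge> 0\<close> \<open>\<epsilon> > 0\<close> by (simp add: field_simps)
    have cI: "continuous_on (cbox lo hi) (\<lambda>\<omega>. of_real (w \<omega>) *
          H (of_real (a \<omega>) * z) (of_real (c \<omega>) * z) (poly p (of_real (c \<omega>) * z)))"
      using pR R z by (intro continuous_on_integrand[OF star sub]) (force intro!: continuous_intros)+
    have "K (poly p) z - poly Q z = integral (cbox lo hi) (\<lambda>\<omega>. of_real (w \<omega>) *
          H (of_real (a \<omega>) * z) (of_real (c \<omega>) * z) (poly p (of_real (c \<omega>) * z)) - of_real (w \<omega>) * J z \<omega>)"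
      unfolding K_def int_J[symmetric]
      by (intro integral_diff[symmetric] integrable_continuous cI continuous_intros cont cont_J)
    also have "norm \<dots> \<le> \<epsilon> / 2"
    proof (rule norm_integral_le_if_measure_le_1[OF _ measure_le])
      fix \<omega> assume \<omega>: "\<omega> \<in> cbox lo hi"
      let ?a = "of_real (a \<omega>) * z" and ?c = "of_real (c \<omega>) * z"
      have in_r: "?a \<in> cball 0 r" "?c \<in> cball 0 r" using star[OF z] unit[OF \<omega>] by blast+
      have "norm (H ?a ?c (poly p ?c) - J z \<omega>) \<le> \<epsilon> / 2"
        unfolding J_def using in_r sub pR[OF in_r(2)] R by (intro F) (auto simp: subset_iff)
      thus "norm (of_real (w \<omega>) * H ?a ?c (poly p ?c) - of_real (w \<omega>) * J z \<omega>) \<le> \<epsilon> / 2"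
        unfolding right_diff_distrib[symmetric] by (rule norm_weight_mult_le[OF \<omega>])
    qed (use \<open>\<epsilon> > 0\<close> in \<open>auto intro!: continuous_intros cI cont cont_J\<close>)
    finally have 3: "norm (K (poly p) z - poly Q z) \<le> \<epsilon> / 2" .
    show ?thesis
      using norm_triangle_ineq[of "K U z - K (poly p) z" "K (poly p) z - poly Q z"] 1 2 3
      by (smt (verit) diff_add_cancel add_diff_eq field_sum_of_halves)
  qed
  thus "\<exists>Q. \<forall>z\<in>cball 0 r. norm (K U z - poly Q z) \<le> \<epsilon>" by blast
qed

end

subsection \<open>Picard iteration on a disc and on a segment\<close>

text \<open>Star-shapedness about 0: the points \<open>a x\<close> and \<open>c x\<close> sampled by
  an average never leave the set.\<close>

definition segment_closed :: "complex set \<Rightarrow> bool" where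
  "segment_closed S \<longleftrightarrow> (\<forall>x\<in>S. \<forall>s\<in>{0..1}. of_real s * x \<in> S)"

lemma segment_closed_cball: "segment_closed (cball 0 r)"
  unfolding segment_closed_def
proof (intro ballI)
  fix x :: complex and s :: real assume "x \<in> cball 0 r" "s \<in> {0..1}"
  thus "of_real s * x \<in> cball 0 r"
    using mult_right_mono[of "\<bar>s\<bar>" 1 "norm x"] by (simp add: norm_mult)
qed

lemma segment_closed_real_segment: "segment_closed (of_real ` {0..r})"
  unfolding segment_closed_def
proof (intro ballI)
  fix x :: complex and s :: real assume "x \<in> of_real ` {0..r}" "s \<in> {0..1}"
  then obtain y where "x = of_real y" "0 \<le> y" "y \<le> r" "0 \<le> s" "s \<le> 1" by auto
  thus "of_real s * x \<in> of_real ` {0..r}"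
    using mult_left_le_one_le[of y s] by (intro image_eqI[of _ _ "s * y"]) auto
qed

text \<open>The estimates are local in \<open>S\<close> because they are needed both on a complex disc, where the Picard
  iterates converge, and on a real segment, where the given solution lives.\<close>

definition analytic_operator :: "real \<Rightarrow> real \<Rightarrow> real \<Rightarrow> ((complex \<Rightarrow> complex) \<Rightarrow> complex \<Rightarrow> complex) \<Rightarrow> bool" where
  "analytic_operator R M L K \<longleftrightarrow> M \<ge> 0 \<and> L \<ge> 0 \<and>
     (\<forall>S U x. segment_closed S \<longrightarrow> S \<subseteq> cball 0 R \<longrightarrow> continuous_on S U \<longrightarrow> (\<forall>x\<in>S. norm (U x) \<le> R) \<longrightarrow>
        x \<in> S \<longrightarrow> norm (K U x) \<le> M) \<and>
     (\<forall>S U V \<delta> x. segment_closed S \<longrightarrow> S \<subseteq> cball 0 R \<longrightarrow>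
        continuous_on S U \<longrightarrow> (\<forall>x\<in>S. norm (U x) \<le> R) \<longrightarrow>
        continuous_on S V \<longrightarrow> (\<forall>x\<in>S. norm (V x) \<le> R) \<longrightarrow>
        (\<forall>x\<in>S. norm (U x - V x) \<le> \<delta>) \<longrightarrow> x \<in> S \<longrightarrow> norm (K U x - K V x) \<le> L * \<delta>) \<and>
     (\<forall>r\<le>R. \<forall>U\<in>disc_algebra r. (\<forall>x\<in>cball 0 r. norm (U x) \<le> R) \<longrightarrow> K U \<in> disc_algebra r)"

lemma analytic_operatorD:
  assumes "analytic_operator R M L K"
  shows "M \<ge> 0" "L \<ge> 0"
    "segment_closed S \<Longrightarrow> S \<subseteq> cball 0 R \<Longrightarrow> continuous_on S U \<Longrightarrow> \<forall>x\<in>S. norm (U x) \<le> R \<Longrightarrow>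
       x \<in> S \<Longrightarrow> norm (K U x) \<le> M"
    "segment_closed S \<Longrightarrow> S \<subseteq> cball 0 R \<Longrightarrow> continuous_on S U \<Longrightarrow> \<forall>x\<in>S. norm (U x) \<le> R \<Longrightarrow>
       continuous_on S V \<Longrightarrow> \<forall>x\<in>S. norm (V x) \<le> R \<Longrightarrow> \<forall>x\<in>S. norm (U x - V x) \<le> \<delta> \<Longrightarrow> x \<in> S \<Longrightarrow>
       norm (K U x - K V x) \<le> L * \<delta>"
    "r \<le> R \<Longrightarrow> U \<in> disc_algebra r \<Longrightarrow> \<forall>x\<in>cball 0 r. norm (U x) \<le> R \<Longrightarrow> K U \<in> disc_algebra r"
proof -
  note * = assms[unfolded analytic_operator_def]
  note conj = *[THEN conjunct2, THEN conjunct2]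
  show "M \<ge> 0" "L \<ge> 0" using * by simp_all
  show "segment_closed S \<Longrightarrow> S \<subseteq> cball 0 R \<Longrightarrow> continuous_on S U \<Longrightarrow> \<forall>x\<in>S. norm (U x) \<le> R \<Longrightarrow>
       x \<in> S \<Longrightarrow> norm (K U x) \<le> M"
    using conj[THEN conjunct1] by simp
  show "segment_closed S \<Longrightarrow> S \<subseteq> cball 0 R \<Longrightarrow> continuous_on S U \<Longrightarrow> \<forall>x\<in>S. norm (U x) \<le> R \<Longrightarrow>
       continuous_on S V \<Longrightarrow> \<forall>x\<in>S. norm (V x) \<le> R \<Longrightarrow> \<forall>x\<in>S. norm (U x - V x) \<le> \<delta> \<Longrightarrow> x \<in> S \<Longrightarrow>
       norm (K U x - K V x) \<le> L * \<delta>"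
    using conj[THEN conjunct2, THEN conjunct1, rule_format, of S U V \<delta> x] by blast
  show "r \<le> R \<Longrightarrow> U \<in> disc_algebra r \<Longrightarrow> \<forall>x\<in>cball 0 r. norm (U x) \<le> R \<Longrightarrow> K U \<in> disc_algebra r"
    using conj[THEN conjunct2, THEN conjunct2] by blast
qed

lemma (in power_series_operator) analytic_operator_K: "analytic_operator R M (M / (2 * R)) K"
proof -
  have "norm (K U x) \<le> M" if "segment_closed S" "S \<subseteq> cball 0 R" "continuous_on S U"
    "\<forall>x\<in>S. norm (U x) \<le> R" "x \<in> S" for S U x
  proof (rule norm_K_le[of S])
    show "S \<subseteq> cball 0 (4 * R)" using that(2) R by force
    show "norm (U x) \<le> 4 * R" if "x \<in> S" for x
      using \<open>\<forall>x\<in>S. norm (U x) \<le> R\<close> that R by force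
  qed (use that in \<open>auto simp: segment_closed_def\<close>)
  moreover have "norm (K U x - K V x) \<le> M / (2 * R) * \<delta>"
    if "segment_closed S" "S \<subseteq> cball 0 R" "continuous_on S U" "\<forall>x\<in>S. norm (U x) \<le> R"
      "continuous_on S V" "\<forall>x\<in>S. norm (V x) \<le> R" "\<forall>x\<in>S. norm (U x - V x) \<le> \<delta>" "x \<in> S"
    for S U V \<delta> x
  proof (rule K_lipschitz[of S])
    show "S \<subseteq> cball 0 (4 * R)" using that(2) R by force
    show "norm (U x) \<le> 2 * R" "norm (V x) \<le> 2 * R" if "x \<in> S" for x
      using \<open>\<forall>x\<in>S. norm (U x) \<le> R\<close> \<open>\<forall>x\<in>S. norm (V x) \<le> R\<close> that R by force+
  qed (use that in \<open>auto simp: segment_closed_def\<close>)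
  moreover have "K U \<in> disc_algebra r"
    if "r \<le> R" "U \<in> disc_algebra r" "\<forall>x\<in>cball 0 r. norm (U x) \<le> R" for r U
    using K_disc_algebra[of U r] that R by auto
  moreover have "M / (2 * R) \<ge> 0" using M_nonneg R by simp
  ultimately show ?thesis
    unfolding analytic_operator_def using M_nonneg
    by (intro conjI allI impI ballI) auto
qed

text \<open>Merges the f-average and the g-average into one operator. The second carries the extra
  factor x^n from the inner kernel, a polynomial, so the disc algebra is preserved.\<close>

lemma analytic_operator_combine:
  assumes "analytic_operator R M1 L1 K1" "analytic_operator R M2 L2 K2" "R > 0"
  shows "analytic_operator R (norm \<kappa>1 * M1 + norm \<kappa>2 * R ^ n * M2) (norm \<kappa>1 * L1 + norm \<kappa>2 * R ^ n * L2)
    (\<lambda>U x. \<kappa>1 * K1 U x + \<kappa>2 * x ^ n * K2 U x)"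
proof -
  note 1 = analytic_operatorD[OF assms(1)]
  note 2 = analytic_operatorD[OF assms(2)]
  \<comment> \<open>One estimate for two uses: with values of the operators it gives the bound, with
    differences the Lipschitz property.\<close>
  have comb: "norm (\<kappa>1 * p + \<kappa>2 * x ^ n * q) \<le> norm \<kappa>1 * A + norm \<kappa>2 * R ^ n * B"
    if "norm p \<le> A" "norm q \<le> B" "x \<in> S" "S \<subseteq> cball 0 R" for p q x A B S
  proof -
    have "norm x \<le> R" "0 \<le> B" using that order_trans[OF norm_ge_zero that(2)] by auto
    hence "norm (\<kappa>2 * x ^ n * q) \<le> norm \<kappa>2 * R ^ n * B"
      unfolding norm_mult norm_power using that assms(3) by (intro mult_mono power_mono) auto
    moreover have "norm (\<kappa>1 * p) \<le> norm \<kappa>1 * A"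
      unfolding norm_mult using that by (intro mult_left_mono) auto
    ultimately show ?thesis using norm_triangle_ineq[of "\<kappa>1 * p" "\<kappa>2 * x ^ n * q"] by linarith
  qed
  show ?thesis
    unfolding analytic_operator_def
  proof (intro conjI allI impI ballI)
    show "0 \<le> norm \<kappa>1 * M1 + norm \<kappa>2 * R ^ n * M2" "0 \<le> norm \<kappa>1 * L1 + norm \<kappa>2 * R ^ n * L2"
      using 1 2 assms(3) by auto
  next
    fix S x and U :: "complex \<Rightarrow> complex"
    assume "segment_closed S" "S \<subseteq> cball 0 R" "continuous_on S U" "\<forall>x\<in>S. norm (U x) \<le> R" "x \<in> S"
    thus "norm (\<kappa>1 * K1 U x + \<kappa>2 * x ^ n * K2 U x) \<le> norm \<kappa>1 * M1 + norm \<kappa>2 * R ^ n * M2"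
      by (intro comb[of _ _ _ _ _ S] 1(3)[of S] 2(3)[of S])
  next
    fix S \<delta> x and U V :: "complex \<Rightarrow> complex"
    assume *: "segment_closed S" "S \<subseteq> cball 0 R" "continuous_on S U" "\<forall>x\<in>S. norm (U x) \<le> R"
      "continuous_on S V" "\<forall>x\<in>S. norm (V x) \<le> R" "\<forall>x\<in>S. norm (U x - V x) \<le> \<delta>" "x \<in> S"
    have "norm (\<kappa>1 * (K1 U x - K1 V x) + \<kappa>2 * x ^ n * (K2 U x - K2 V x)) \<le>
        norm \<kappa>1 * (L1 * \<delta>) + norm \<kappa>2 * R ^ n * (L2 * \<delta>)"
      using * by (intro comb[of _ _ _ _ _ S] 1(4)[of S] 2(4)[of S])
    thus "norm (\<kappa>1 * K1 U x + \<kappa>2 * x ^ n * K2 U x - (\<kappa>1 * K1 V x + \<kappa>2 * x ^ n * K2 V x)) \<le>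
        (norm \<kappa>1 * L1 + norm \<kappa>2 * R ^ n * L2) * \<delta>"
      by (simp add: algebra_simps)
  next
    fix r and U :: "complex \<Rightarrow> complex" assume *: "r \<le> R" "U \<in> disc_algebra r" "\<forall>x\<in>cball 0 r. norm (U x) \<le> R"
    have "(\<lambda>z. poly [:\<kappa>1:] z * K1 U z + poly (monom \<kappa>2 n) z * K2 U z) \<in> disc_algebra r"
      using * by (intro disc_algebra_add disc_algebra_poly_mult 1(5) 2(5))
    thus "(\<lambda>x. \<kappa>1 * K1 U x + \<kappa>2 * x ^ n * K2 U x) \<in> disc_algebra r"
      by (simp add: poly_monom)
  qed
qed

text \<open>As m \<ge> 1, the factor x^m is small near 0 and makes the map a contraction, however
  large M and L are. The order of quantifiers matters: \<open>V\<close> and \<open>r\<close> come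
  from the operator alone, and only \<open>r2\<close> depends on \<open>U\<close>.\<close>

lemma analytic_operator_fixed_point:
  assumes "analytic_operator R M L K" "R > 0" "poly P 0 = 0" "m \<ge> (1::nat)"
  obtains V r where "r > 0" "V \<in> disc_algebra r"
    "\<forall>U r1. 0 < r1 \<and> continuous_on (of_real ` {0..r1}) U \<and> U 0 = 0 \<and>
       (\<forall>x\<in>of_real ` {0..r1}. U x = poly P x + x ^ m * K U x) \<longrightarrow>
       (\<exists>r2>0. r2 \<le> r1 \<and> (\<forall>x\<in>of_real ` {0..r2}. U x = poly P x + x ^ m * V x))"
proof -
  note MLpos = analytic_operatorD(1,2)[OF assms(1)]
  note K_bound = analytic_operatorD(3)[OF assms(1)]
  note K_lip = analytic_operatorD(4)[OF assms(1)]
  note K_disc = analytic_operatorD(5)[OF assms(1)]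
  have "isCont (poly P) 0" by simp
  then obtain d where d: "d > 0" "\<And>x. norm x < d \<Longrightarrow> norm (poly P x) < R / 2"
    unfolding continuous_at_eps_delta using assms(2,3)
    by (metis half_gt_zero dist_norm diff_zero)
  \<comment> \<open>Here \<open>d / 2\<close> gives |P| \<le> R/2 and
    \<open>R / (2 * (M + 1))\<close> bounds the other summand by R/2, so the bound R is preserved;
    \<open>1 / (2 * (L + 1))\<close> gives the contraction factor 1/2, and r \<le> 1 gives |x^m|
    \<le> r.\<close>
  define r where "r = Min {1, R, d / 2, R / (2 * (M + 1)), 1 / (2 * (L + 1))}"
  have "r > 0" unfolding r_def using assms(2) d MLpos by auto
  moreover have "r \<le> 1" "r \<le> R" "r \<le> d / 2" "r \<le> R / (2 * (M + 1))" "r \<le> 1 / (2 * (L + 1))"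
    unfolding r_def by (rule Min_le; simp)+
  ultimately have r: "r > 0" "r \<le> 1" "r \<le> R" "r \<le> d / 2" "r \<le> R / (2 * (M + 1))" "r \<le> 1 / (2 * (L + 1))"
    by simp_all
  have "r * (M + 1) \<le> R / 2" "r * (L + 1) \<le> 1 / 2"
    using r(5,6) MLpos by (auto simp: field_simps)
  hence rM: "r * M \<le> R / 2" and rL: "r * L \<le> 1 / 2" using r(1) by (auto simp: algebra_simps)
  have xm: "norm (x ^ m) \<le> r" if "norm x \<le> r" for x :: complex
  proof -
    have "norm x ^ m \<le> norm x ^ 1" using that r assms(4) by (intro power_decreasing) auto
    thus ?thesis using that by (simp add: norm_power)
  qed
  have Pr: "norm (poly P x) \<le> R / 2" if "norm x \<le> r" for x
    using d(2)[of x] that r(4) d(1) by simp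
  define T where "T = (\<lambda>U x. poly P x + x ^ m * K U x)"
  have T_bound: "norm (T U x) \<le> R"
    if "segment_closed S" "S \<subseteq> cball 0 r" "continuous_on S U" "\<forall>x\<in>S. norm (U x) \<le> R" "x \<in> S" for S U x
  proof -
    have x: "norm x \<le> r" using that by auto
    have "norm (K U x) \<le> M" using that r(3) by (intro K_bound[of S]) auto
    hence "norm (x ^ m * K U x) \<le> r * M"
      unfolding norm_mult using xm[OF x] r(1) by (intro mult_mono) auto
    thus ?thesis unfolding T_def using norm_triangle_ineq[of "poly P x" "x ^ m * K U x"] Pr[OF x] rM by linarith
  qed
  have T_lip: "norm (T U x - T V x) \<le> \<delta> / 2"
    if "segment_closed S" "S \<subseteq> cball 0 r" "continuous_on S U" "\<forall>x\<in>S. norm (U x) \<le> R"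
      "continuous_on S V" "\<forall>x\<in>S. norm (V x) \<le> R" "\<forall>x\<in>S. norm (U x - V x) \<le> \<delta>" "x \<in> S" for S U V \<delta> x
  proof -
    have x: "norm x \<le> r" using that by auto
    have "norm (K U x - K V x) \<le> L * \<delta>" using that r(3) by (intro K_lip[of S]) auto
    hence "norm (x ^ m * (K U x - K V x)) \<le> r * (L * \<delta>)"
      unfolding norm_mult using xm[OF x] r(1) by (intro mult_mono) auto
    also have "\<dots> \<le> 1 / 2 * \<delta>"
      unfolding mult.assoc[symmetric]
    proof (rule mult_right_mono[OF rL])
      show "0 \<le> \<delta>" using that(7,8) norm_ge_zero order_trans by blast
    qed
    finally show ?thesis by (simp add: T_def algebra_simps)
  qed
  define Y where "Y = (\<lambda>k. (T ^^ k) (\<lambda>_. 0))"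
  have Y_0: "Y 0 = (\<lambda>_. 0)" and Y_Suc: "Y (Suc k) = T (Y k)" for k by (simp_all add: Y_def)
  have Y: "Y k \<in> disc_algebra r \<and> (\<forall>x\<in>cball 0 r. norm (Y k x) \<le> R)" for k
  proof (induction k)
    case 0
    have "poly 0 = (\<lambda>_::complex. 0)" by auto
    thus ?case using poly_in_disc_algebra[of 0 r] assms(2) by (simp add: Y_0)
  next
    case (Suc k)
    have "(\<lambda>z. poly P z + poly (monom 1 m) z * K (Y k) z) \<in> disc_algebra r"
      using Suc r(3) by (intro disc_algebra_add disc_algebra_poly_mult poly_in_disc_algebra K_disc) auto
    hence "T (Y k) \<in> disc_algebra r" by (simp add: T_def poly_monom)
    thus ?case unfolding Y_Suc
      using T_bound[OF segment_closed_cball order_refl disc_algebra_continuous_holomorphic(1)] Suc by blast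
  qed
  have Y_cont: "continuous_on (cball 0 r) (Y k)" for k
    using Y disc_algebra_continuous_holomorphic(1) by blast
  \<comment> \<open>The iteration starts at 0, so every iterate is within R of \<open>Y 0\<close>;
    applying the map to both sides halves the distance.\<close>
  have Y_Cauchy: "\<forall>x\<in>cball 0 r. norm (Y (k + j) x - Y k x) \<le> R / 2 ^ k" for k j
  proof (induction k)
    case 0
    show ?case using Y by (simp add: Y_0)
  next
    case (Suc k)
    have "norm (T (Y (k + j)) x - T (Y k) x) \<le> (R / 2 ^ k) / 2" if "x \<in> cball 0 r" for x
      using Suc Y Y_cont that by (intro T_lip[OF segment_closed_cball order_refl]) auto
    thus ?case by (simp add: Y_Suc mult.commute)
  qed
  have to_0: "(\<lambda>k. R / 2 ^ k) \<longlonglongrightarrow> 0"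
    using tendsto_mult_right_zero[OF LIMSEQ_power_zero[of "1 / 2 :: real"], of R] by (simp add: power_divide)
  have conv: "convergent (\<lambda>k. Y k x)" if "x \<in> cball 0 r" for x
    unfolding Cauchy_convergent_iff[symmetric] Cauchy_altdef2
  proof (intro allI impI)
    fix e :: real assume "e > 0"
    then obtain N where "R / 2 ^ N < e"
      using order_tendstoD(2)[OF to_0] by (auto simp: eventually_sequentially)
    moreover have "dist (Y n x) (Y N x) \<le> R / 2 ^ N" if "n \<ge> N" for n
      using Y_Cauchy[of N "n - N"] \<open>x \<in> cball 0 r\<close> that by (simp add: dist_norm)
    ultimately show "\<exists>N. \<forall>n\<ge>N. dist (Y n x) (Y N x) < e" by force
  qed
  define W where "W = (\<lambda>x. lim (\<lambda>k. Y k x))"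
  have W: "(\<lambda>k. Y k x) \<longlonglongrightarrow> W x" if "x \<in> cball 0 r" for x
    using conv[OF that] by (simp add: W_def convergent_LIMSEQ_iff)
  have W_Y: "norm (W x - Y k x) \<le> R / 2 ^ k" if "x \<in> cball 0 r" for x k
  proof (rule LIMSEQ_le_const2)
    show "(\<lambda>j. norm (Y j x - Y k x)) \<longlonglongrightarrow> norm (W x - Y k x)"
      by (intro tendsto_intros W that)
    show "\<exists>N. \<forall>n\<ge>N. norm (Y n x - Y k x) \<le> R / 2 ^ k"
      using Y_Cauchy[of k] that by (metis le_add_diff_inverse)
  qed
  have W_bound: "norm (W x) \<le> R" if "x \<in> cball 0 r" for x
    using W_Y[OF that, of 0] by (simp add: Y_0)
  have W_disc: "W \<in> disc_algebra r"
  proof (rule disc_algebra_limit)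
    fix e :: real assume "e > 0"
    then obtain N where "R / 2 ^ N < e"
      using order_tendstoD(2)[OF to_0] by (auto simp: eventually_sequentially)
    thus "\<exists>\<psi>\<in>disc_algebra r. \<forall>z\<in>cball 0 r. norm (W z - \<psi> z) \<le> e"
      using W_Y[of _ N] Y[of N] by (intro bexI[of _ "Y N"]) force+
  qed
  show thesis
  proof (rule that[OF r(1), of "K W"])
    show "K W \<in> disc_algebra r" using W_disc W_bound r(3) by (intro K_disc) auto
    show "\<forall>U r1. 0 < r1 \<and> continuous_on (of_real ` {0..r1}) U \<and> U 0 = 0 \<and>
       (\<forall>x\<in>of_real ` {0..r1}. U x = poly P x + x ^ m * K U x) \<longrightarrow>
       (\<exists>r2>0. r2 \<le> r1 \<and> (\<forall>x\<in>of_real ` {0..r2}. U x = poly P x + x ^ m * K W x))"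
    proof (intro allI impI, elim conjE)
      fix U :: "complex \<Rightarrow> complex" and r1 :: real
      assume U: "0 < r1" "continuous_on (of_real ` {0..r1}) U" "U 0 = 0"
        and U_eq: "\<forall>x\<in>of_real ` {0..r1}. U x = poly P x + x ^ m * K U x"
      have "(0::complex) \<in> of_real ` {0..r1}" using U(1) by (intro image_eqI[of _ _ 0]) auto
      \<comment> \<open>No bound on \<open>U\<close> is assumed; continuity and
        \<open>U 0 = 0\<close> supply |U| \<le> R on a shorter segment.\<close>
      then obtain e where e: "e > 0" "\<And>x. x \<in> of_real ` {0..r1} \<Longrightarrow> norm x < e \<Longrightarrow> norm (U x) < R"
        using U(2,3) assms(2) unfolding continuous_on_iff by (metis dist_norm diff_zero)
      define r2 where "r2 = Min {r, r1, e / 2}"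
      have r2: "r2 > 0" "r2 \<le> r" "r2 \<le> r1" "r2 \<le> e / 2" using r(1) U(1) e(1) by (auto simp: r2_def)
      define S :: "complex set" where "S = of_real ` {0..r2}"
      have S: "segment_closed S" "S \<subseteq> cball 0 r" "S \<subseteq> of_real ` {0..r1}"
        using r2 by (auto simp: S_def segment_closed_real_segment)
      have US: "continuous_on S U" "\<forall>x\<in>S. norm (U x) \<le> R"
      proof -
        show "continuous_on S U" using U(2) S(3) continuous_on_subset by blast
        have "norm x < e" if "x \<in> S" for x using that r2 e by (auto simp: S_def)
        thus "\<forall>x\<in>S. norm (U x) \<le> R" using e(2) S(3) less_imp_le by blast
      qed
      have YS: "continuous_on S (Y k)" "\<forall>x\<in>S. norm (Y k x) \<le> R" for k
        using Y_cont Y S(2) continuous_on_subset by blast+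
      \<comment> \<open>\<open>U\<close> is fixed by \<open>T\<close> on \<open>S\<close>, so its
        distance to the iterates halves at each step. This identifies \<open>U\<close> with
        \<open>W\<close> there and yields local uniqueness.\<close>
      have U_Y: "\<forall>x\<in>S. norm (U x - Y k x) \<le> R / 2 ^ k" for k
      proof (induction k)
        case 0
        show ?case using US by (simp add: Y_0)
      next
        case (Suc k)
        have "norm (T U x - T (Y k) x) \<le> (R / 2 ^ k) / 2" if "x \<in> S" for x
          using Suc US YS that by (intro T_lip[OF S(1,2)]) auto
        moreover have "T U x = U x" if "x \<in> S" for x using U_eq S(3) that unfolding T_def by auto
        ultimately show ?case by (simp add: Y_Suc mult.commute)
      qed
      have U_W: "U x = W x" if "x \<in> S" for x
      proof (rule LIMSEQ_unique)
        show "(\<lambda>k. Y k x) \<longlonglongrightarrow> W x" using W S(2) that by blast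
        have "(\<lambda>k. Y k x - U x) \<longlonglongrightarrow> 0"
          using U_Y that by (intro Lim_null_comparison[OF _ to_0]) (auto simp: norm_minus_commute)
        thus "(\<lambda>k. Y k x) \<longlonglongrightarrow> U x" by (simp add: LIM_zero_iff)
      qed
      \<comment> \<open>The Lipschitz estimate with \<delta> = 0: \<open>K\<close> sees its argument
        only along \<open>S\<close>. The equation assumed for \<open>U\<close> then gives the
        claim.\<close>
      have "K U x = K W x" if "x \<in> S" for x
      proof -
        have "norm (K U x - K W x) \<le> L * 0"
          using S US U_W W_bound disc_algebra_continuous_holomorphic(1)[OF W_disc] r(3) that
          by (intro K_lip[of S]) (auto intro: continuous_on_subset)
        thus ?thesis by simp
      qed
      hence "\<forall>x\<in>S. U x = poly P x + x ^ m * K W x" using U_eq S(3) by (metis subsetD)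
      thus "\<exists>r2>0. r2 \<le> r1 \<and> (\<forall>x\<in>of_real ` {0..r2}. U x = poly P x + x ^ m * K W x)"
        using r2 unfolding S_def by blast
    qed
  qed
qed

subsection \<open>Removing the singular kernels\<close>

text \<open>Up to the constant -\<gamma> / t^\<gamma>, the kernel is the derivative of (1 -
  s/t)^\<gamma>, so the singularity is spent on the change of variable and a continuous integrand
  remains. At t = 0 both sides vanish.\<close>

lemma integral_weakly_singular_substitution:
  fixes h :: "real \<Rightarrow> real"
  assumes "\<gamma> > 0" "t \<ge> 0" and h: "continuous_on {0..t} h"
  shows "integral {0..t} (\<lambda>s. (t - s) powr (\<gamma> - 1) * h s) =
    t powr \<gamma> / \<gamma> * integral {0..1} (\<lambda>v. h (t * (1 - v powr (1 / \<gamma>))))"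
proof (cases "t = 0")
  case False
  hence t: "t > 0" using assms(2) by simp
  define \<phi> where "\<phi> = (\<lambda>s. (1 - s / t) powr \<gamma>)"
  define \<phi>' where "\<phi>' = (\<lambda>s. - (\<gamma> / t powr \<gamma>) * (t - s) powr (\<gamma> - 1))"
  define F where "F = (\<lambda>v. h (t * (1 - v powr (1 / \<gamma>))))"
  have pw: "v powr (1 / \<gamma>) \<le> 1" if "v \<in> {0..1}" for v :: real
    using that assms(1) by (intro powr_le1) auto
  have cont_F: "continuous_on {0..1} F"
    unfolding F_def
  proof (rule continuous_on_compose2[OF h])
    show "continuous_on {0..1} (\<lambda>v. t * (1 - v powr (1 / \<gamma>)))"
      using assms(1) by (intro continuous_intros continuous_on_powr') auto
    show "(\<lambda>v. t * (1 - v powr (1 / \<gamma>))) ` {0..1} \<subseteq> {0..t}"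
      using pw t by (auto simp: mult_le_cancel_left1)
  qed
  have "((\<lambda>s. \<phi>' s *\<^sub>R F (\<phi> s)) has_integral (integral {\<phi> 0..\<phi> t} F - integral {\<phi> t..\<phi> 0} F)) {0..t}"
  \<comment> \<open>The endpoint t is exceptional: for \<gamma> < 1 the derivative of
    \<open>\<phi>\<close> is unbounded there, while \<open>\<phi>\<close> stays continuous.\<close>
  proof (rule has_integral_substitution_general[of "{t}", OF _ _ _ cont_F])
    show "\<phi> ` {0..t} \<subseteq> {0..1}"
      using t assms(1) by (auto simp: \<phi>_def intro!: powr_le1)
    show "continuous_on {0..t} \<phi>"
      unfolding \<phi>_def using t assms(1) by (intro continuous_intros continuous_on_powr') auto
    fix s assume s: "s \<in> {0..t} - {t}"
    hence pos: "1 - s / t > 0" using t by auto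
    have "(\<phi> has_field_derivative \<gamma> * (1 - s / t) powr (\<gamma> - 1) * (- 1 / t)) (at s within {0..t})"
      unfolding \<phi>_def using pos t by (auto intro!: derivative_eq_intros simp: field_simps powr_diff)
    also have "\<gamma> * (1 - s / t) powr (\<gamma> - 1) * (- 1 / t) = \<phi>' s"
    proof -
      have "1 - s / t = (t - s) / t" using t by (simp add: field_simps)
      hence "(1 - s / t) powr (\<gamma> - 1) = (t - s) powr (\<gamma> - 1) * t / t powr \<gamma>"
        using s t by (simp add: powr_divide powr_diff)
      thus ?thesis using t by (simp add: \<phi>'_def field_simps)
    qed
    finally show "(\<phi> has_field_derivative \<phi>' s) (at s within {0..t})" .
  qed (use t in auto)
  moreover have "\<phi> 0 = 1" "\<phi> t = 0" using t by (auto simp: \<phi>_def)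
  \<comment> \<open>\<open>\<phi>\<close> decreases from 1 to 0, so only the reversed integral
    survives, with a minus sign.\<close>
  ultimately have "((\<lambda>s. \<phi>' s * F (\<phi> s)) has_integral (- integral {0..1} F)) {0..t}" by simp
  hence "((\<lambda>s. - (t powr \<gamma> / \<gamma>) * (\<phi>' s * F (\<phi> s))) has_integral
      - (t powr \<gamma> / \<gamma>) * (- integral {0..1} F)) {0..t}"
    by (rule has_integral_mult_right)
  moreover have "- (t powr \<gamma> / \<gamma>) * (\<phi>' s * F (\<phi> s)) = (t - s) powr (\<gamma> - 1) * h s" if "s \<in> {0..t}" for s
  proof -
    have "\<phi> s powr (1 / \<gamma>) = 1 - s / t"
      unfolding \<phi>_def using that t assms(1) by (simp add: powr_powr)
    hence "F (\<phi> s) = h s" using t by (simp add: F_def)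
    thus ?thesis using t assms(1) by (simp add: \<phi>'_def)
  qed
  ultimately have "((\<lambda>s. (t - s) powr (\<gamma> - 1) * h s) has_integral
      - (t powr \<gamma> / \<gamma>) * (- integral {0..1} F)) {0..t}"
    by (rule has_integral_eq[rotated])
  hence "((\<lambda>s. (t - s) powr (\<gamma> - 1) * h s) has_integral t powr \<gamma> / \<gamma> * integral {0..1} F) {0..t}"
    by simp
  thus ?thesis unfolding F_def by (rule integral_unique)
qed simp

text \<open>The substitution \<open>v = (1 - s / t) powr \<gamma>\<close> absorbs the kernel \<open>(t - s) powr (\<gamma> - 1)\<close>; in the
  variable \<open>x = t powr (1 / b)\<close> it moves the evaluation point \<open>s powr (1 / b)\<close> to \<open>x * node \<gamma> b v\<close>.\<close>

definition node :: "real \<Rightarrow> nat \<Rightarrow> real \<Rightarrow> real" where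
  "node \<gamma> b v = (1 - v powr (1 / \<gamma>)) powr (1 / real b)"

lemma one_minus_powr_unit:
  fixes \<gamma> v :: real
  assumes "\<gamma> > 0" "v \<in> {0..1}"
  shows "1 - v powr (1 / \<gamma>) \<in> {0..1}"
  using assms powr_le1[of "1 / \<gamma>" v] by auto

lemma node_unit:
  assumes "\<gamma> > 0" "v \<in> {0..1}"
  shows "node \<gamma> b v \<in> {0..1}"
  unfolding node_def using one_minus_powr_unit[OF assms] by (auto intro!: powr_le1)

lemma powr_inverse_power: "e \<ge> 0 \<Longrightarrow> b \<ge> 1 \<Longrightarrow> (e powr (1 / real b)) ^ b = e"
  by (cases "e = 0") (auto simp: powr_power)

lemma node_power:
  assumes "\<gamma> > 0" "b \<ge> 1" "v \<in> {0..1}"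
  shows "node \<gamma> b v ^ b = 1 - v powr (1 / \<gamma>)"
  unfolding node_def using one_minus_powr_unit[OF assms(1,3)] assms(2)
  by (intro powr_inverse_power) simp_all

lemma continuous_on_node:
  assumes "\<gamma> > 0" "b \<ge> 1"
  shows "continuous_on {0..1} (node \<gamma> b)"
proof -
  have "continuous_on {0..1} (\<lambda>v::real. 1 - v powr (1 / \<gamma>))"
    using assms by (intro continuous_intros continuous_on_powr') auto
  hence "continuous_on {0..1} (\<lambda>v. (1 - v powr (1 / \<gamma>)) powr (1 / real b))"
  proof (rule continuous_on_powr')
    show "\<forall>v\<in>{0..1}. 0 \<le> 1 - v powr (1 / \<gamma>) \<and> (1 - v powr (1 / \<gamma>) = 0 \<longrightarrow> 0 < 1 / real b)"
    proof
      fix v :: real assume "v \<in> {0..1}"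
      thus "0 \<le> 1 - v powr (1 / \<gamma>) \<and> (1 - v powr (1 / \<gamma>) = 0 \<longrightarrow> 0 < 1 / real b)"
        using one_minus_powr_unit[OF assms(1), of v] assms(2) by simp
    qed
  qed (rule continuous_on_const)
  thus ?thesis by (simp add: node_def[abs_def])
qed

text \<open>Here integrality of \<gamma> b enters: with z = x it turns t^\<alpha> into x^m. The case
  z = 0 is sound because k > 0.\<close>

lemma power_powr_eq:
  fixes z \<gamma> :: real
  assumes "z \<ge> 0" "real k = \<gamma> * real b" "\<gamma> > 0" "b \<ge> 1"
  shows "(z ^ b) powr \<gamma> = z ^ k"
proof (cases "z = 0")
  case True
  have "real k > 0" using assms by simp
  thus ?thesis using True assms(4) by (simp add: power_0_left)
next
  case False
  have "z ^ b = z powr real b" using False assms(1) by (simp add: powr_realpow)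
  hence "(z ^ b) powr \<gamma> = z powr (real b * \<gamma>)" by (simp only: powr_powr)
  also have "\<dots> = z powr real k" unfolding assms(2) by (simp only: mult.commute)
  also have "\<dots> = z ^ k" using False assms(1) by (simp add: powr_realpow)
  finally show ?thesis .
qed

text \<open>The kernel substitution is applied to both nested integrals. The inner one is taken at
  \<tau> = (x p(v))^b and contributes \<tau>^\<beta> = x^n p(v)^n, the origin of the power of
  \<open>p v\<close> in \<open>G\<close>.\<close>

lemma caputo_solution_substitution:
  fixes \<alpha> \<beta> T lam x :: real and f :: "real \<Rightarrow> real \<Rightarrow> real" and g :: "real \<Rightarrow> real \<Rightarrow> real \<Rightarrow> real" and b m n :: nat
  defines "p \<equiv> node \<alpha> b"
    and "q \<equiv> node \<beta> b"
  assumes "\<alpha> > 0" "\<beta> > 0" "b \<ge> 1" and m: "real m = \<alpha> * real b" and n: "real n = \<beta> * real b"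
    and f: "continuous_on ({0..T} \<times> UNIV) (\<lambda>(t, y). f t y)"
    and g: "continuous_on ({(t, s). 0 \<le> s \<and> s \<le> t \<and> t \<le> T} \<times> UNIV) (\<lambda>((t, s), y). g t s y)"
    and sol: "caputo_ivp_continuous_solution \<alpha> \<beta> T lam f g y0 y"
    and x: "0 \<le> x" "x ^ b \<le> T"
  defines "F \<equiv> \<lambda>v. f ((x * p v) ^ b) (y ((x * p v) ^ b))"
    and "G \<equiv> \<lambda>(v, w). p v ^ n * g ((x * p v) ^ b) ((x * (p v * q w)) ^ b) (y ((x * (p v * q w)) ^ b))"
  shows "F integrable_on {0..1}" "G integrable_on cbox (0, 0) (1, 1)"
    "y (x ^ b) = taylor_initial \<alpha> y0 (x ^ b) + x ^ m / (\<alpha> * Gamma \<alpha>) * integral {0..1} F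
       + lam * x ^ (m + n) / (\<alpha> * \<beta> * Gamma \<alpha>) * integral (cbox (0, 0) (1, 1)) G"
proof -
  define t where "t = x ^ b"
  have t: "0 \<le> t" "t \<le> T" using x by (simp_all add: t_def)
  have y: "continuous_on {0..T} y"
    by (rule conjunct1[OF sol[unfolded caputo_ivp_continuous_solution_def]])
  note p = node_unit[OF \<open>\<alpha> > 0\<close>, of _ b, folded p_def]
  note pb = node_power[OF \<open>\<alpha> > 0\<close> \<open>b \<ge> 1\<close>, folded p_def]
  note qb = node_power[OF \<open>\<beta> > 0\<close> \<open>b \<ge> 1\<close>, folded q_def]
  note cont_p = continuous_on_node[OF \<open>\<alpha> > 0\<close> \<open>b \<ge> 1\<close>, folded p_def]
  have in_T: "(x * p v) ^ b \<in> {0..t}" if "v \<in> {0..1}" for v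
  proof -
    have "0 \<le> x * p v" "x * p v \<le> x" using p[OF that] x(1) by (auto intro: mult_left_le)
    thus ?thesis using power_mono[of "x * p v" x b] by (simp add: t_def)
  qed

  have "continuous_on {0..T} (\<lambda>s. (\<lambda>(t, y). f t y) (s, y s))"
    by (intro continuous_on_compose2[OF f] continuous_intros y) auto
  hence cont_fy: "continuous_on {0..T} (\<lambda>s. f s (y s))" by simp
  have cont_F: "continuous_on {0..1} F"
    unfolding F_def using in_T t
    by (intro continuous_on_compose2[OF cont_fy] continuous_intros cont_p) force+
  thus "F integrable_on {0..1}" by (rule integrable_continuous_real)

  \<comment> \<open>The inner integrand after the substitution: it has no singular kernel and is
    jointly continuous on a fixed rectangle, \<tau> = 0 included.\<close>
  define G0 where "G0 = (\<lambda>\<tau> w. g \<tau> (\<tau> * (1 - w powr (1 / \<beta>))) (y (\<tau> * (1 - w powr (1 / \<beta>)))))"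
  have cont_G0: "continuous_on ({0..T} \<times> {0..1}) (\<lambda>(\<tau>, w). G0 \<tau> w)"
  proof -
    have 1: "continuous_on ({0..T} \<times> {0..1}) (\<lambda>z. fst z * (1 - snd z powr (1 / \<beta>)))"
      using \<open>\<beta> > 0\<close> by (intro continuous_intros continuous_on_powr') auto
    have 2: "0 \<le> fst z * (1 - snd z powr (1 / \<beta>)) \<and> fst z * (1 - snd z powr (1 / \<beta>)) \<le> fst z"
      if "z \<in> {0..T} \<times> {0..1}" for z
      using that one_minus_powr_unit[of \<beta> "snd z"] \<open>\<beta> > 0\<close> by (auto simp: mult_left_le mem_Times_iff)
    have "continuous_on ({0..T} \<times> {0..1}) (\<lambda>z. y (fst z * (1 - snd z powr (1 / \<beta>))))"
      using 2 by (intro continuous_on_compose2[OF y 1]) fastforce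
    hence "continuous_on ({0..T} \<times> {0..1})
        (\<lambda>z. ((fst z, fst z * (1 - snd z powr (1 / \<beta>))), y (fst z * (1 - snd z powr (1 / \<beta>)))))"
      by (intro continuous_intros 1)
    hence "continuous_on ({0..T} \<times> {0..1})
        (\<lambda>z. (\<lambda>((t, s), y). g t s y)
          ((fst z, fst z * (1 - snd z powr (1 / \<beta>))), y (fst z * (1 - snd z powr (1 / \<beta>)))))"
    proof (rule continuous_on_compose2[OF g], intro image_subsetI)
      fix z :: "real \<times> real" assume "z \<in> {0..T} \<times> {0..1}"
      thus "((fst z, fst z * (1 - snd z powr (1 / \<beta>))), y (fst z * (1 - snd z powr (1 / \<beta>)))) \<in>
          {(t, s). 0 \<le> s \<and> s \<le> t \<and> t \<le> T} \<times> UNIV"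
        using 2[of z] by (simp add: mem_Times_iff)
    qed
    thus ?thesis by (simp add: G0_def case_prod_unfold)
  qed
  define h where "h = (\<lambda>\<tau>. integral {0..\<tau>} (\<lambda>s. (\<tau> - s) powr (\<beta> - 1) * g \<tau> s (y s)))"
  have h: "h \<tau> = \<tau> powr \<beta> / \<beta> * integral {0..1} (G0 \<tau>)" if "\<tau> \<in> {0..T}" for \<tau>
    unfolding h_def G0_def
  proof (rule integral_weakly_singular_substitution[OF \<open>\<beta> > 0\<close>])
    have "continuous_on {0..\<tau>} (\<lambda>s. (\<lambda>((t, s), y). g t s y) ((\<tau>, s), y s))"
      using that continuous_on_subset[OF y, of "{0..\<tau>}"]
      by (intro continuous_on_compose2[OF g] continuous_intros) auto
    thus "continuous_on {0..\<tau>} (\<lambda>s. g \<tau> s (y s))" by simp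
  qed (use that in simp)
  \<comment> \<open>Continuity of the inner integral is read off from its substituted form; it is
    the hypothesis for substituting in the outer integral.\<close>
  have "continuous_on {0..T} (\<lambda>\<tau>. \<tau> powr \<beta> / \<beta> * integral (cbox 0 1) (G0 \<tau>))"
    using \<open>\<beta> > 0\<close> cont_G0
    by (intro continuous_intros continuous_on_powr' integral_continuous_on_param) auto
  hence cont_h: "continuous_on {0..t} h"
    using t continuous_on_cong[OF refl h, of "{0..T}"] continuous_on_subset[of "{0..T}" h "{0..t}"]
    by (simp add: cbox_interval)

  have Geq: "G (v, w) = p v ^ n * G0 ((x * p v) ^ b) w" if "v \<in> {0..1}" "w \<in> {0..1}" for v w
    using qb[OF that(2)] by (simp add: G_def G0_def power_mult_distrib mult_ac)
  have cont_G: "continuous_on (cbox (0, 0) (1, 1)) G"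
  proof -
    have c: "continuous_on ({0..1} \<times> {0..1}) (\<lambda>z::real \<times> real. p (fst z))"
      by (rule continuous_on_compose2[OF cont_p]) (auto intro: continuous_intros)
    have "continuous_on ({0..1} \<times> {0..1}) (\<lambda>z. (\<lambda>(\<tau>, w). G0 \<tau> w) ((x * p (fst z)) ^ b, snd z))"
      using in_T t by (intro continuous_on_compose2[OF cont_G0] continuous_intros c) force+
    hence "continuous_on ({0..1} \<times> {0..1}) (\<lambda>z. p (fst z) ^ n * G0 ((x * p (fst z)) ^ b) (snd z))"
      by (auto intro!: continuous_intros c)
    thus ?thesis
      unfolding cbox_Pair_eq unfolding cbox_interval by (rule continuous_on_eq) (auto simp: Geq)
  qed
  thus "G integrable_on cbox (0, 0) (1, 1)" by (rule integrable_continuous)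

  have t_powr: "t powr \<alpha> = x ^ m" unfolding t_def using x m \<open>\<alpha> > 0\<close> \<open>b \<ge> 1\<close> by (intro power_powr_eq)
  have tp: "t * (1 - v powr (1 / \<alpha>)) = (x * p v) ^ b" if "v \<in> {0..1}" for v
    using pb[OF that] by (simp add: t_def power_mult_distrib)
  have I1: "RL_integral \<alpha> (\<lambda>s. f s (y s)) t = x ^ m / (\<alpha> * Gamma \<alpha>) * integral {0..1} F"
  proof -
    have "integral {0..t} (\<lambda>s. (t - s) powr (\<alpha> - 1) * f s (y s)) =
        t powr \<alpha> / \<alpha> * integral {0..1} (\<lambda>v. f (t * (1 - v powr (1 / \<alpha>))) (y (t * (1 - v powr (1 / \<alpha>)))))"
      using t \<open>\<alpha> > 0\<close> continuous_on_subset[OF cont_fy, of "{0..t}"]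
      by (intro integral_weakly_singular_substitution) auto
    also have "integral {0..1} (\<lambda>v. f (t * (1 - v powr (1 / \<alpha>))) (y (t * (1 - v powr (1 / \<alpha>))))) =
        integral {0..1} F"
      by (rule integral_cong) (simp only: F_def tp)
    finally show ?thesis by (simp add: RL_integral_def t_powr)
  qed
  have I2: "RL_integral \<alpha> h t = x ^ (m + n) / (\<alpha> * \<beta> * Gamma \<alpha>) * integral (cbox (0, 0) (1, 1)) G"
  proof -
    have "integral {0..t} (\<lambda>s. (t - s) powr (\<alpha> - 1) * h s) =
        x ^ m / \<alpha> * integral {0..1} (\<lambda>v. h (t * (1 - v powr (1 / \<alpha>))))"
      unfolding t_powr[symmetric] using t cont_h \<open>\<alpha> > 0\<close>
      by (intro integral_weakly_singular_substitution)
    also have "integral {0..1} (\<lambda>v. h (t * (1 - v powr (1 / \<alpha>)))) =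
        integral {0..1} (\<lambda>v. x ^ n / \<beta> * integral {0..1} (\<lambda>w. G (v, w)))"
    proof (rule integral_cong)
      fix v :: real assume v: "v \<in> {0..1}"
      have "h (t * (1 - v powr (1 / \<alpha>))) = ((x * p v) ^ b) powr \<beta> / \<beta> * integral {0..1} (G0 ((x * p v) ^ b))"
        unfolding tp[OF v] using in_T[OF v] t by (intro h) auto
      also have "((x * p v) ^ b) powr \<beta> = (x * p v) ^ n"
        using p[OF v] x n \<open>\<beta> > 0\<close> \<open>b \<ge> 1\<close> by (intro power_powr_eq) auto
      also have "(x * p v) ^ n / \<beta> * integral {0..1} (G0 ((x * p v) ^ b)) =
          x ^ n / \<beta> * integral {0..1} (\<lambda>w. p v ^ n * G0 ((x * p v) ^ b) w)"
        by (simp add: power_mult_distrib)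
      also have "integral {0..1} (\<lambda>w. p v ^ n * G0 ((x * p v) ^ b) w) = integral {0..1} (\<lambda>w. G (v, w))"
        using v by (intro integral_cong) (simp add: Geq)
      finally show "h (t * (1 - v powr (1 / \<alpha>))) = x ^ n / \<beta> * integral {0..1} (\<lambda>w. G (v, w))" .
    qed
    also have "\<dots> = x ^ n / \<beta> * integral (cbox (0, 0) (1, 1)) G"
      by (simp add: integral_prod_continuous[OF cont_G])
    finally show ?thesis by (simp add: RL_integral_def power_add mult_ac)
  qed
  have "y t = taylor_initial \<alpha> y0 t + RL_integral \<alpha> (\<lambda>s. f s (y s)) t + lam * RL_integral \<alpha> h t"
    unfolding h_def
    by (rule bspec[OF conjunct2[OF sol[unfolded caputo_ivp_continuous_solution_def]]]) (use t in simp)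
  thus "y (x ^ b) = taylor_initial \<alpha> y0 (x ^ b) + x ^ m / (\<alpha> * Gamma \<alpha>) * integral {0..1} F
       + lam * x ^ (m + n) / (\<alpha> * \<beta> * Gamma \<alpha>) * integral (cbox (0, 0) (1, 1)) G"
    unfolding I1 I2 by (simp only: t_def times_divide_eq_right times_divide_eq_left mult.assoc)
qed

subsection \<open>Operators built from real analytic functions\<close>

lemma integral_complex_of_real_eq:
  fixes f :: "'a::euclidean_space \<Rightarrow> real"
  assumes "f integrable_on S"
  shows "integral S (\<lambda>x. complex_of_real (f x)) = of_real (integral S f)"
  using integral_linear[OF assms bounded_linear_of_real[where 'a = complex]] by (simp add: o_def)

text \<open>The real coefficients define a series at complex arguments too, and at real
  \<open>x\<close> the operator returns the real integral. \<open>U\<close> is prescribed only at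
  the points sampled by the average.\<close>

lemma analytic2_operator:
  fixes F :: "real \<times> real \<Rightarrow> real" and p :: "real \<Rightarrow> real"
  assumes sums: "\<And>x y. \<bar>x\<bar> < \<rho> \<Longrightarrow> \<bar>y - \<eta>\<bar> < \<rho> \<Longrightarrow>
      ((\<lambda>(i, j). C i j * x ^ i * (y - \<eta>) ^ j) has_sum F (x, y)) UNIV"
    and R: "0 < R" "4 * R < \<rho>"
    and p: "continuous_on {0..1} p" "\<And>v. v \<in> {0..1} \<Longrightarrow> p v \<in> {0..1}"
  obtains K M L where "analytic_operator R M L K"
    "\<And>U u x. 0 \<le> x \<Longrightarrow> x \<le> 4 * R \<Longrightarrow> (\<And>v. v \<in> {0..1} \<Longrightarrow> U (of_real (x * p v)) = of_real (u v)) \<Longrightarrow>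
       (\<And>v. v \<in> {0..1} \<Longrightarrow> \<bar>u v\<bar> \<le> 4 * R) \<Longrightarrow> (\<lambda>v. F (x * p v, \<eta> + u v)) integrable_on {0..1} \<Longrightarrow>
       K U (of_real x) = of_real (integral {0..1} (\<lambda>v. F (x * p v, \<eta> + u v)))"
proof -
  let ?C = "\<lambda>ij. complex_of_real (C (fst ij) (snd ij))"
  \<comment> \<open>As 4R < \<rho>, the expansion holds at (4R, \<eta> + 4R); unordered convergence
    of reals is absolute, which is the required majorant.\<close>
  have "(\<lambda>(i, j). C i j * (4 * R) ^ i * (4 * R) ^ j) summable_on UNIV"
    using sums[of "4 * R" "\<eta> + 4 * R"] R by (auto simp: summable_on_def)
  note this[THEN iffD1[OF summable_on_iff_abs_summable_on_real]]
  hence summable: "(\<lambda>ij. norm (?C ij) * (4 * R) ^ (0 + fst ij + snd ij)) summable_on UNIV"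
    using R(1) by (simp add: case_prod_unfold abs_mult power_add mult.assoc)
  \<comment> \<open>With \<open>e1 = 0\<close> the first argument of \<open>H\<close> is a dummy,
    hence the arbitrary \<open>z\<close> below.\<close>
  interpret P: power_series_operator ?C "\<lambda>_. 0" fst snd R "\<lambda>_. 1" "\<lambda>_. 1" p 0 "1::real"
  proof unfold_locales
    show "continuous_on (cbox 0 1) p" using p(1) by simp
    show "(1::real) \<in> {0..1} \<and> (1::real) \<in> {0..1} \<and> p v \<in> {0..1}" if "v \<in> cbox 0 1" for v
      using p(2)[of v] that by simp
  qed (use R(1) summable in simp_all)
  have H: "P.H z (of_real x) (of_real u) = of_real (F (x, \<eta> + u))"
    if "\<bar>x\<bar> \<le> 4 * R" "\<bar>u\<bar> \<le> 4 * R" for z x u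
  proof -
    have "((\<lambda>(i, j). C i j * x ^ i * u ^ j) has_sum F (x, \<eta> + u)) UNIV"
      using sums[of x "\<eta> + u"] that R by simp
    hence "((\<lambda>ij. complex_of_real ((\<lambda>(i, j). C i j * x ^ i * u ^ j) ij)) has_sum of_real (F (x, \<eta> + u))) UNIV"
      by (rule has_sum_of_real)
    thus ?thesis unfolding P.H_def by (intro infsumI) (simp add: case_prod_unfold)
  qed
  show thesis
  proof (rule that[OF P.analytic_operator_K])
    fix U :: "complex \<Rightarrow> complex" and u x
    assume *: "0 \<le> x" "x \<le> 4 * R" "\<And>v. v \<in> {0..1} \<Longrightarrow> U (of_real (x * p v)) = of_real (u v)"
      "\<And>v. v \<in> {0..1} \<Longrightarrow> \<bar>u v\<bar> \<le> 4 * R" "(\<lambda>v. F (x * p v, \<eta> + u v)) integrable_on {0..1}"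
    have "P.K U (of_real x) = integral {0..1} (\<lambda>v. complex_of_real (F (x * p v, \<eta> + u v)))"
      unfolding P.K_def cbox_interval
    proof (rule integral_cong)
      fix v :: real assume v: "v \<in> {0..1}"
      have "0 \<le> x * p v" "x * p v \<le> x" using p(2)[OF v] *(1) by (auto intro: mult_left_le)
      hence "P.H z (of_real (x * p v)) (of_real (u v)) = of_real (F (x * p v, \<eta> + u v))" for z
        using *(2) *(4)[OF v] by (intro H) auto
      thus "of_real 1 * P.H (of_real 1 * of_real x) (of_real (p v) * of_real x) (U (of_real (p v) * of_real x)) =
          complex_of_real (F (x * p v, \<eta> + u v))"
        using *(3)[OF v] by (simp add: mult.commute)
    qed
    also have "\<dots> = of_real (integral {0..1} (\<lambda>v. F (x * p v, \<eta> + u v)))"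
      by (rule integral_complex_of_real_eq) fact
    finally show "P.K U (of_real x) = of_real (integral {0..1} (\<lambda>v. F (x * p v, \<eta> + u v)))" .
  qed
qed

lemma analytic3_operator:
  fixes G :: "real \<times> real \<times> real \<Rightarrow> real" and w a c :: "real \<times> real \<Rightarrow> real"
  defines "Q \<equiv> cbox (0, 0) (1, 1)"
  assumes sums: "\<And>x y z. \<bar>x\<bar> < \<rho> \<Longrightarrow> \<bar>y\<bar> < \<rho> \<Longrightarrow> \<bar>z - \<eta>\<bar> < \<rho> \<Longrightarrow>
      ((\<lambda>(i, j, k). C i j k * x ^ i * y ^ j * (z - \<eta>) ^ k) has_sum G (x, y, z)) UNIV"
    and R: "0 < R" "4 * R < \<rho>"
    and cont: "continuous_on Q w" "continuous_on Q a" "continuous_on Q c"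
    and unit: "\<And>v. v \<in> Q \<Longrightarrow> w v \<in> {0..1} \<and> a v \<in> {0..1} \<and> c v \<in> {0..1}"
  obtains K M L where "analytic_operator R M L K"
    "\<And>U u x. 0 \<le> x \<Longrightarrow> x \<le> 4 * R \<Longrightarrow> (\<And>v. v \<in> Q \<Longrightarrow> U (of_real (x * c v)) = of_real (u v)) \<Longrightarrow>
       (\<And>v. v \<in> Q \<Longrightarrow> \<bar>u v\<bar> \<le> 4 * R) \<Longrightarrow> (\<lambda>v. w v * G (x * a v, x * c v, \<eta> + u v)) integrable_on Q \<Longrightarrow>
       K U (of_real x) = of_real (integral Q (\<lambda>v. w v * G (x * a v, x * c v, \<eta> + u v)))"
proof -
  let ?C = "\<lambda>n. complex_of_real (C (fst n) (fst (snd n)) (snd (snd n)))"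
  have "(\<lambda>(i, j, k). C i j k * (4 * R) ^ i * (4 * R) ^ j * (4 * R) ^ k) summable_on UNIV"
    using sums[of "4 * R" "4 * R" "\<eta> + 4 * R"] R by (auto simp: summable_on_def)
  note this[THEN iffD1[OF summable_on_iff_abs_summable_on_real]]
  hence summable: "(\<lambda>n. norm (?C n) * (4 * R) ^ (fst n + fst (snd n) + snd (snd n))) summable_on UNIV"
    using R(1) by (simp add: case_prod_unfold abs_mult power_add mult.assoc)
  interpret P: power_series_operator ?C fst "fst \<circ> snd" "snd \<circ> snd" R w a c "(0, 0)" "(1, 1)"
  proof unfold_locales
    show "measure lborel (cbox (0, 0) (1, 1) :: (real \<times> real) set) \<le> 1"
      by (simp add: content_Pair)
  qed (use R(1) summable cont unit in \<open>simp_all add: Q_def\<close>)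
  have H: "P.H (of_real x) (of_real y) (of_real u) = of_real (G (x, y, \<eta> + u))"
    if "\<bar>x\<bar> \<le> 4 * R" "\<bar>y\<bar> \<le> 4 * R" "\<bar>u\<bar> \<le> 4 * R" for x y u
  proof -
    have "((\<lambda>(i, j, k). C i j k * x ^ i * y ^ j * u ^ k) has_sum G (x, y, \<eta> + u)) UNIV"
      using sums[of x y "\<eta> + u"] that R by simp
    hence "((\<lambda>n. complex_of_real ((\<lambda>(i, j, k). C i j k * x ^ i * y ^ j * u ^ k) n)) has_sum
        of_real (G (x, y, \<eta> + u))) UNIV"
      by (rule has_sum_of_real)
    thus ?thesis unfolding P.H_def by (intro infsumI) (simp add: case_prod_unfold)
  qed
  show thesis
  proof (rule that[OF P.analytic_operator_K])
    fix U :: "complex \<Rightarrow> complex" and u x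
    assume *: "0 \<le> x" "x \<le> 4 * R" "\<And>v. v \<in> Q \<Longrightarrow> U (of_real (x * c v)) = of_real (u v)"
      "\<And>v. v \<in> Q \<Longrightarrow> \<bar>u v\<bar> \<le> 4 * R" "(\<lambda>v. w v * G (x * a v, x * c v, \<eta> + u v)) integrable_on Q"
    have "P.K U (of_real x) = integral Q (\<lambda>v. complex_of_real (w v * G (x * a v, x * c v, \<eta> + u v)))"
      unfolding P.K_def Q_def[symmetric]
    proof (rule integral_cong)
      fix v assume v: "v \<in> Q"
      have "0 \<le> x * a v" "x * a v \<le> x" "0 \<le> x * c v" "x * c v \<le> x"
        using unit[OF v] *(1) by (auto intro: mult_left_le)
      hence "P.H (of_real (x * a v)) (of_real (x * c v)) (of_real (u v)) =
          of_real (G (x * a v, x * c v, \<eta> + u v))"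
        using *(2) *(4)[OF v] by (intro H) auto
      thus "of_real (w v) * P.H (of_real (a v) * of_real x) (of_real (c v) * of_real x)
          (U (of_real (c v) * of_real x)) = complex_of_real (w v * G (x * a v, x * c v, \<eta> + u v))"
        using *(3)[OF v] by (simp add: mult.commute)
    qed
    also have "\<dots> = of_real (integral Q (\<lambda>v. w v * G (x * a v, x * c v, \<eta> + u v)))"
      by (rule integral_complex_of_real_eq) fact
    finally show "P.K U (of_real x) = of_real (integral Q (\<lambda>v. w v * G (x * a v, x * c v, \<eta> + u v)))" .
  qed
qed

section \<open>Boxes inside open sets, which reduce membership in \<open>Uf\<close> and
  \<open>Ug\<close> to coordinate bounds\<close>

lemma open_contains_box2:
  fixes U :: "(real \<times> real) set"
  assumes "open U" "(x0, y0) \<in> U"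
  shows "\<exists>e>0. \<forall>x y. \<bar>x - x0\<bar> < e \<longrightarrow> \<bar>y - y0\<bar> < e \<longrightarrow> (x, y) \<in> U"
proof -
  obtain A B where AB: "open A" "open B" "(x0, y0) \<in> A \<times> B" "A \<times> B \<subseteq> U"
    using open_prod_elim[OF assms] .
  obtain d e where "d > 0" "ball x0 d \<subseteq> A" "e > 0" "ball y0 e \<subseteq> B"
    using AB by (meson SigmaE2 openE)
  thus ?thesis using AB(4)
    by (intro exI[of _ "min d e"]) (auto simp: subset_iff dist_real_def abs_minus_commute)
qed

lemma open_contains_box3:
  fixes U :: "(real \<times> real \<times> real) set"
  assumes "open U" "(x0, y0, z0) \<in> U"
  shows "\<exists>e>0. \<forall>x y z. \<bar>x - x0\<bar> < e \<longrightarrow> \<bar>y - y0\<bar> < e \<longrightarrow> \<bar>z - z0\<bar> < e \<longrightarrow> (x, y, z) \<in> U"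
proof -
  obtain A B where AB: "open A" "open B" "(x0, y0, z0) \<in> A \<times> B" "A \<times> B \<subseteq> U"
    using open_prod_elim[OF assms] .
  obtain d where d: "d > 0" "ball x0 d \<subseteq> A" using AB by (meson SigmaE2 openE)
  obtain e where e: "e > 0" "\<forall>y z. \<bar>y - y0\<bar> < e \<longrightarrow> \<bar>z - z0\<bar> < e \<longrightarrow> (y, z) \<in> B"
    using open_contains_box2[of B y0 z0] AB by auto
  show ?thesis using AB(4) d e
    by (intro exI[of _ "min d e"]) (auto simp: subset_iff dist_real_def abs_minus_commute)
qed

subsection \<open>Series representation of the solution\<close>

text \<open>\<open>ybar\<close> is quantified before \<open>y\<close> because the coefficients are
  determined by the data; \<omega> may depend on the solution. At t = 0 each \<open>powr\<close>
  term is 0, in agreement with the positive exponents.\<close>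

theorem theorem2:
  fixes a1 b1 a2 b2 b m :: nat
    and \<alpha> \<beta> T lam :: real
    and y0 :: "nat \<Rightarrow> real"
    and f :: "real \<Rightarrow> real \<Rightarrow> real"
    and g :: "real \<Rightarrow> real \<Rightarrow> real \<Rightarrow> real"
    and fbar :: "real \<times> real \<Rightarrow> real" and Uf :: "(real \<times> real) set"
    and gbar :: "real \<times> real \<times> real \<Rightarrow> real" and Ug :: "(real \<times> real \<times> real) set"
    and D :: "(real \<times> real) set"
  assumes "coprime a1 b1" "a1 \<ge> 1" "b1 \<ge> 2" "\<alpha> = real a1 / real b1" "\<alpha> > 0"
    and "coprime a2 b2" "a2 \<ge> 1" "b2 \<ge> 2" "\<beta> = real a2 / real b2" "\<beta> \<in> {0<..1}"
    and "b = lcm b1 b2"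
    and "real m = \<alpha> * real b"
    and "T > 0"
    and "D = {(t, s). 0 \<le> s \<and> s \<le> t \<and> t \<le> T}"
    and "continuous_on ({0..T} \<times> UNIV) (\<lambda>(t, y). f t y)"
    and "continuous_on (D \<times> UNIV) (\<lambda>((t, s), y). g t s y)"
    and "open Uf" "(0, y0 0) \<in> Uf" "real_analytic2_on fbar Uf"
    and "\<And>t y. t \<in> {0..T} \<Longrightarrow> (t powr (1 / real b), y) \<in> Uf \<Longrightarrow>
           f t y = fbar (t powr (1 / real b), y)"
    and "open Ug" "(0, 0, y0 0) \<in> Ug" "real_analytic3_on gbar Ug"
    and "\<And>t s y. (t, s) \<in> D \<Longrightarrow> (t powr (1 / real b), s powr (1 / real b), y) \<in> Ug \<Longrightarrow>
           g t s y = gbar (t powr (1 / real b), s powr (1 / real b), y)"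
  shows "\<exists>ybar :: nat \<Rightarrow> real. \<forall>y. caputo_ivp_continuous_solution \<alpha> \<beta> T lam f g y0 y \<longrightarrow>
           (\<exists>\<omega>. 0 < \<omega> \<and> \<omega> \<le> T \<and> (\<forall>t\<in>{0..<\<omega>}.
              summable (\<lambda>n. ybar (m + n) * t powr (real (m + n) / real b)) \<and>
              y t = taylor_initial \<alpha> y0 t
                    + (\<Sum>n. ybar (m + n) * t powr (real (m + n) / real b))))"
proof -
  note \<alpha> = assms(5)
  have \<beta>: "\<beta> > 0" using assms(10) by simp
  have b: "b \<ge> 1" using assms(3,8,11) by (simp add: Suc_le_eq lcm_pos_nat)
  note m = assms(12) and T = assms(13)
  have m1: "m \<ge> 1"
  proof -
    have "real m > 0" unfolding m using \<alpha> b by simp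
    thus ?thesis by simp
  qed
  obtain n :: nat where n: "real n = \<beta> * real b"
  proof -
    \<comment> \<open>Since b2 divides b, \<beta> b = a2 k is an integer.\<close>
    obtain k where "b = b2 * k" using assms(11) by (metis dvd_def dvd_lcm2)
    thus thesis using that[of "a2 * k"] assms(8,9) by simp
  qed
  define N where "N = nat \<lceil>\<alpha>\<rceil>"
  have N: "N \<ge> 1" using \<alpha> by (simp add: N_def Suc_le_eq)
  define \<eta> where "\<eta> = y0 0"

  obtain rf cf where rf: "rf > 0" "\<And>x y. \<bar>x\<bar> < rf \<Longrightarrow> \<bar>y - \<eta>\<bar> < rf \<Longrightarrow>
      ((\<lambda>(i, j). cf i j * x ^ i * (y - \<eta>) ^ j) has_sum fbar (x, y)) UNIV"
    using bspec[OF assms(19)[unfolded real_analytic2_on_def] assms(18)] unfolding \<eta>_def by auto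
  have "\<exists>r>0. \<exists>c :: nat \<Rightarrow> nat \<Rightarrow> nat \<Rightarrow> real. \<forall>x y z. \<bar>x\<bar> < r \<longrightarrow> \<bar>y\<bar> < r \<longrightarrow> \<bar>z - \<eta>\<bar> < r \<longrightarrow>
      ((\<lambda>(i, j, k). c i j k * x ^ i * y ^ j * (z - \<eta>) ^ k) has_sum gbar (x, y, z)) UNIV"
    using bspec[OF assms(23)[unfolded real_analytic3_on_def] assms(22)] unfolding \<eta>_def by simp
  then obtain rg cg where rg: "rg > 0" "\<And>x y z. \<bar>x\<bar> < rg \<Longrightarrow> \<bar>y\<bar> < rg \<Longrightarrow> \<bar>z - \<eta>\<bar> < rg \<Longrightarrow>
      ((\<lambda>(i, j, k). cg i j k * x ^ i * y ^ j * (z - \<eta>) ^ k) has_sum gbar (x, y, z)) UNIV"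
    by blast
  obtain ef where ef: "ef > 0" "\<And>x y. \<bar>x\<bar> < ef \<Longrightarrow> \<bar>y - \<eta>\<bar> < ef \<Longrightarrow> (x, y) \<in> Uf"
    using open_contains_box2[OF assms(17,18)] unfolding \<eta>_def by auto
  obtain eg where eg: "eg > 0" "\<And>x y z. \<bar>x\<bar> < eg \<Longrightarrow> \<bar>y\<bar> < eg \<Longrightarrow> \<bar>z - \<eta>\<bar> < eg \<Longrightarrow> (x, y, z) \<in> Ug"
    using open_contains_box3[OF assms(21,22)] unfolding \<eta>_def by auto
  \<comment> \<open>Dividing by 8 makes 4R half of the smallest radius, hence strictly inside all
    boxes.\<close>
  define R where "R = min (min rf rg) (min ef eg) / 8"
  have R: "R > 0" "4 * R < rf" "4 * R < rg" "4 * R < ef" "4 * R < eg"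
    using rf(1) rg(1) ef(1) eg(1) by (auto simp: R_def min_def)

  define p where "p = node \<alpha> b"
  define q where "q = node \<beta> b"
  have p: "p v \<in> {0..1}" if "v \<in> {0..1}" for v
    unfolding p_def by (rule node_unit[OF \<alpha> that])
  have q: "q v \<in> {0..1}" if "v \<in> {0..1}" for v
    unfolding q_def by (rule node_unit[OF \<beta> that])
  have cont_p: "continuous_on {0..1} p" unfolding p_def by (rule continuous_on_node[OF \<alpha> b])
  have cont_q: "continuous_on {0..1} q" unfolding q_def by (rule continuous_on_node[OF \<beta> b])
  let ?Q = "cbox (0, 0) (1, 1) :: (real \<times> real) set"
  have Q: "fst v \<in> {0..1}" "snd v \<in> {0..1}" if "v \<in> ?Q" for v
    using that unfolding cbox_Pair_eq by (auto simp: mem_Times_iff)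
  have cont_pq: "continuous_on ?Q (\<lambda>v. p (fst v))" "continuous_on ?Q (\<lambda>v. q (snd v))"
    using Q by (auto intro!: continuous_on_compose2[OF cont_p] continuous_on_compose2[OF cont_q] continuous_intros)
  have pq: "p (fst v) * q (snd v) \<in> {0..1}" if "v \<in> ?Q" for v
    using p[OF Q(1)[OF that]] q[OF Q(2)[OF that]] by (auto intro: mult_le_one)

  obtain K1 M1 L1 where K1: "analytic_operator R M1 L1 K1"
    "\<And>U u x. 0 \<le> x \<Longrightarrow> x \<le> 4 * R \<Longrightarrow> (\<And>v. v \<in> {0..1} \<Longrightarrow> U (of_real (x * p v)) = of_real (u v)) \<Longrightarrow>
       (\<And>v. v \<in> {0..1} \<Longrightarrow> \<bar>u v\<bar> \<le> 4 * R) \<Longrightarrow> (\<lambda>v. fbar (x * p v, \<eta> + u v)) integrable_on {0..1} \<Longrightarrow>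
       K1 U (of_real x) = of_real (integral {0..1} (\<lambda>v. fbar (x * p v, \<eta> + u v)))"
    by (rule analytic2_operator[OF rf(2) R(1,2) cont_p p]) (assumption | blast)+
  obtain K2 M2 L2 where K2: "analytic_operator R M2 L2 K2"
    "\<And>U u x. 0 \<le> x \<Longrightarrow> x \<le> 4 * R \<Longrightarrow>
       (\<And>v. v \<in> ?Q \<Longrightarrow> U (of_real (x * (p (fst v) * q (snd v)))) = of_real (u v)) \<Longrightarrow>
       (\<And>v. v \<in> ?Q \<Longrightarrow> \<bar>u v\<bar> \<le> 4 * R) \<Longrightarrow>
       (\<lambda>v. p (fst v) ^ n * gbar (x * p (fst v), x * (p (fst v) * q (snd v)), \<eta> + u v)) integrable_on ?Q \<Longrightarrow>
       K2 U (of_real x) = of_real (integral ?Q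
         (\<lambda>v. p (fst v) ^ n * gbar (x * p (fst v), x * (p (fst v) * q (snd v)), \<eta> + u v)))"
  proof (rule analytic3_operator[of rg \<eta> cg gbar R "\<lambda>v. p (fst v) ^ n" "\<lambda>v. p (fst v)" "\<lambda>v. p (fst v) * q (snd v)"])
    show "p (fst v) ^ n \<in> {0..1} \<and> p (fst v) \<in> {0..1} \<and> p (fst v) * q (snd v) \<in> {0..1}" if "v \<in> ?Q" for v
      using p[OF Q(1)[OF that]] pq[OF that] by (auto intro: power_le_one)
  qed (use rg R in \<open>auto intro!: continuous_intros cont_pq\<close>)

  \<comment> \<open>Each substitution contributes the reciprocal of its order: 1/\<alpha> from the
    outer kernel, 1/\<beta> from the inner one; 1 / \<open>Gamma \<alpha>\<close> is the
    normalisation of the fractional integral.\<close>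
  define \<kappa>1 where "\<kappa>1 = 1 / (\<alpha> * Gamma \<alpha>)"
  define \<kappa>2 where "\<kappa>2 = lam / (\<alpha> * \<beta> * Gamma \<alpha>)"
  define K where "K = (\<lambda>U x. of_real \<kappa>1 * K1 U x + of_real \<kappa>2 * x ^ n * K2 U x)"
  \<comment> \<open>The initial polynomial in x, with t^k = x^(bk). The sum starts at k = 1 because
    \<open>y0 0\<close> is subtracted, which gives P(0) = 0.\<close>
  define P :: "complex poly" where "P = (\<Sum>k\<in>{1..<N}. monom (of_real (y0 k / fact k)) (b * k))"
  have P: "poly P (of_real x) = of_real (taylor_initial \<alpha> y0 (x ^ b) - \<eta>)" for x
  proof -
    have "taylor_initial \<alpha> y0 (x ^ b) = \<eta> + (\<Sum>k\<in>{1..<N}. (x ^ b) ^ k / fact k * y0 k)"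
      unfolding taylor_initial_def N_def[symmetric] lessThan_atLeast0
      using N by (subst sum.atLeast_Suc_lessThan) (auto simp: \<eta>_def)
    thus ?thesis by (simp add: P_def poly_sum poly_monom power_mult[symmetric] mult.commute)
  qed
  have P0: "poly P 0 = 0" using b by (simp add: P_def poly_sum poly_monom power_0_left)
  obtain V r where V: "r > 0" "V \<in> disc_algebra r"
    "\<forall>U r1. 0 < r1 \<and> continuous_on (of_real ` {0..r1}) U \<and> U 0 = 0 \<and>
       (\<forall>x\<in>of_real ` {0..r1}. U x = poly P x + x ^ m * K U x) \<longrightarrow>
       (\<exists>r2>0. r2 \<le> r1 \<and> (\<forall>x\<in>of_real ` {0..r2}. U x = poly P x + x ^ m * V x))"
    using analytic_operator_fixed_point[OF
        analytic_operator_combine[OF K1(1) K2(1) R(1), of "of_real \<kappa>1" "of_real \<kappa>2" n, folded K_def] R(1) P0 m1] .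
  define d where "d = (\<lambda>n. (deriv ^^ n) V 0 / fact n)"
  have d: "(\<lambda>n. d n * z ^ n) sums V z" if "norm z < r" for z
    using holomorphic_power_series[OF disc_algebra_continuous_holomorphic(2)[OF V(2)], of z] that
    by (simp add: d_def)

  show ?thesis
  \<comment> \<open>The shift by \<open>m\<close> matches \<open>ybar (m + n)\<close> with the n-th
    Taylor coefficient of \<open>V\<close>.\<close>
  proof (intro exI[of _ "\<lambda>k. Re (d (k - m))"] allI impI)
    fix y assume sol: "caputo_ivp_continuous_solution \<alpha> \<beta> T lam f g y0 y"
    note subst = caputo_solution_substitution[OF \<alpha> \<beta> b m n assms(15) assms(16)[unfolded assms(14)] sol,
        folded p_def q_def]
    have y: "continuous_on {0..T} y"
      by (rule conjunct1[OF sol[unfolded caputo_ivp_continuous_solution_def]])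
    \<comment> \<open>At x = 0 both integral terms disappear because m \<ge> 1.\<close>
    have "y (0 ^ b) = taylor_initial \<alpha> y0 (0 ^ b)"
      using subst(3)[of 0] T b m1 by (simp add: power_0_left)
    hence y_0: "y 0 = \<eta>" using P[of 0] P0 b by (simp add: power_0_left)
    obtain \<delta> where \<delta>: "\<delta> > 0" "\<And>s. s \<in> {0..T} \<Longrightarrow> \<bar>s\<bar> < \<delta> \<Longrightarrow> \<bar>y s - \<eta>\<bar> < 4 * R"
    proof -
      have "\<exists>d>0. \<forall>s\<in>{0..T}. dist s 0 < d \<longrightarrow> dist (y s) (y 0) < 4 * R"
        using y T R(1) unfolding continuous_on_iff
        by (metis atLeastAtMost_iff less_imp_le mult_pos_pos order_refl zero_less_numeral)
      thus thesis using that by (auto simp: dist_real_def y_0)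
    qed
    \<comment> \<open>The bound 1 gives s^b \<le> s, so s \<le> T and s < \<delta> pass to t = s^b;
      the bound 4R keeps s in the boxes.\<close>
    define r1 where "r1 = min (min 1 (4 * R)) (min T (\<delta> / 2))"
    have r1: "r1 > 0" "r1 \<le> 1" "r1 \<le> 4 * R" "r1 \<le> T" "r1 < \<delta>"
      using R(1) T \<delta>(1) by (auto simp: r1_def min_def)
    have seg: "s ^ b \<in> {0..T}" "(s ^ b) powr (1 / real b) = s" "\<bar>s\<bar> \<le> 4 * R" "\<bar>y (s ^ b) - \<eta>\<bar> < 4 * R"
      if "s \<in> {0..r1}" for s
    proof -
      have "s ^ b \<le> s ^ 1" using that r1 b by (intro power_decreasing) auto
      hence "0 \<le> s ^ b" "s ^ b \<le> s" using that by auto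
      thus "s ^ b \<in> {0..T}" "\<bar>y (s ^ b) - \<eta>\<bar> < 4 * R" using that r1 by (auto intro!: \<delta>(2))
      show "(s ^ b) powr (1 / real b) = s"
        using power_powr_eq[of s 1 "1 / real b" b] that b by simp
      show "\<bar>s\<bar> \<le> 4 * R" using that r1 by auto
    qed
    define U where "U = (\<lambda>z. complex_of_real (y (Re z ^ b) - \<eta>))"
    have U: "U (of_real s) = of_real (y (s ^ b) - \<eta>)" for s by (simp add: U_def)
    have "continuous_on (of_real ` {0..r1}) U"
      unfolding U_def using seg(1) by (intro continuous_intros continuous_on_compose2[OF y]) auto
    moreover have "U 0 = 0" using U[of 0] b y_0 by (simp add: power_0_left)
    moreover have "\<forall>z\<in>of_real ` {0..r1}. U z = poly P z + z ^ m * K U z"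
    proof
      fix z :: complex assume "z \<in> of_real ` {0..r1}"
      then obtain x where z: "z = of_real x" and x: "x \<in> {0..r1}" by blast
      have x0: "0 \<le> x" "x ^ b \<le> T" "x \<le> 4 * R" using x seg(1,3)[OF x] by auto
      have xp: "x * s \<in> {0..r1}" if "s \<in> {0..1}" for s
        using that x mult_left_le[of s x] by auto
      \<comment> \<open>The b-th root of (x p(v))^b is x p(v), and this point with the value of y
        lies in the box inside \<open>Uf\<close>, so f may be replaced by
        \<open>fbar\<close>.\<close>
      have F: "f ((x * p v) ^ b) (y ((x * p v) ^ b)) = fbar (x * p v, \<eta> + (y ((x * p v) ^ b) - \<eta>))"
        if "v \<in> {0..1}" for v
      proof -
        note s = seg[OF xp[OF p[OF that]]]
        have "(((x * p v) ^ b) powr (1 / real b), y ((x * p v) ^ b)) \<in> Uf"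
          unfolding s(2) using s(3,4) R(4) by (intro ef(2)) auto
        from assms(20)[OF s(1) this] show ?thesis unfolding s(2) by simp
      qed
      have "K1 U (of_real x) =
          of_real (integral {0..1} (\<lambda>v. fbar (x * p v, \<eta> + (y ((x * p v) ^ b) - \<eta>))))"
      proof (rule K1(2)[where u = "\<lambda>v. y ((x * p v) ^ b) - \<eta>", OF x0(1,3)])
        show "U (of_real (x * p v)) = of_real (y ((x * p v) ^ b) - \<eta>)" for v by (rule U)
        show "\<bar>y ((x * p v) ^ b) - \<eta>\<bar> \<le> 4 * R" if "v \<in> {0..1}" for v
          using seg(4)[OF xp[OF p[OF that]]] by simp
        show "(\<lambda>v. fbar (x * p v, \<eta> + (y ((x * p v) ^ b) - \<eta>))) integrable_on {0..1}"
          by (rule integrable_eq[OF subst(1)[OF x0(1,2)] F])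
      qed
      also have "\<dots> = of_real (integral {0..1} (\<lambda>v. f ((x * p v) ^ b) (y ((x * p v) ^ b))))"
        by (intro arg_cong[of _ _ of_real] integral_cong F[symmetric])
      finally have I1: "K1 U (of_real x) =
        of_real (integral {0..1} (\<lambda>v. f ((x * p v) ^ b) (y ((x * p v) ^ b))))" .

      let ?G = "\<lambda>(v, w). p v ^ n * g ((x * p v) ^ b) ((x * (p v * q w)) ^ b) (y ((x * (p v * q w)) ^ b))"
      let ?s = "\<lambda>v. x * (p (fst v) * q (snd v))"
      have G: "?G v = p (fst v) ^ n * gbar (x * p (fst v), ?s v, \<eta> + (y (?s v ^ b) - \<eta>))" if "v \<in> ?Q" for v
      proof -
        note p' = p[OF Q(1)[OF that]] and q' = q[OF Q(2)[OF that]]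
        note s = seg[OF xp[OF p']] and s' = seg[OF xp[OF pq[OF that]]]
        have "?s v \<le> x * p (fst v)" "0 \<le> ?s v"
          using p' q' x0(1) by (auto intro!: mult_left_mono mult_left_le)
        hence "?s v ^ b \<le> (x * p (fst v)) ^ b" by (rule power_mono)
        hence D: "((x * p (fst v)) ^ b, ?s v ^ b) \<in> D" using s(1) s'(1) by (simp add: assms(14))
        have "(((x * p (fst v)) ^ b) powr (1 / real b), (?s v ^ b) powr (1 / real b), y (?s v ^ b)) \<in> Ug"
          unfolding s(2) s'(2) using s(3) s'(3,4) R(5) by (intro eg(2)) auto
        from assms(24)[OF D this] show ?thesis unfolding s(2) s'(2) by (simp add: case_prod_unfold)
      qed
      have "K2 U (of_real x) = of_real (integral ?Q
          (\<lambda>v. p (fst v) ^ n * gbar (x * p (fst v), ?s v, \<eta> + (y (?s v ^ b) - \<eta>))))"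
      proof (rule K2(2)[where u = "\<lambda>v. y (?s v ^ b) - \<eta>", OF x0(1,3)])
        show "U (of_real (?s v)) = of_real (y (?s v ^ b) - \<eta>)" for v by (rule U)
        show "\<bar>y (?s v ^ b) - \<eta>\<bar> \<le> 4 * R" if "v \<in> ?Q" for v
          using seg(4)[OF xp[OF pq[OF that]]] by simp
        show "(\<lambda>v. p (fst v) ^ n * gbar (x * p (fst v), ?s v, \<eta> + (y (?s v ^ b) - \<eta>))) integrable_on ?Q"
          by (rule integrable_eq[OF subst(2)[OF x0(1,2)] G])
      qed
      also have "\<dots> = of_real (integral ?Q ?G)"
        by (intro arg_cong[of _ _ of_real] integral_cong G[symmetric])
      finally have I2: "K2 U (of_real x) = of_real (integral ?Q ?G)" .

      have "y (x ^ b) - \<eta> = (taylor_initial \<alpha> y0 (x ^ b) - \<eta>) + x ^ m *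
          (\<kappa>1 * integral {0..1} (\<lambda>v. f ((x * p v) ^ b) (y ((x * p v) ^ b))) + \<kappa>2 * x ^ n * integral ?Q ?G)"
        unfolding subst(3)[OF x0(1,2)] \<kappa>1_def \<kappa>2_def by (simp add: power_add algebra_simps)
      hence "U (of_real x) = of_real \<dots>" unfolding U by (rule arg_cong)
      thus "U z = poly P z + z ^ m * K U z" unfolding z K_def I1 I2 P by simp
    qed
    ultimately obtain r2 where r2: "r2 > 0" "r2 \<le> r1"
      "\<forall>x\<in>of_real ` {0..r2}. U x = poly P x + x ^ m * V x"
      using V(3)[rule_format, of r1 U] r1(1) by blast
    define \<rho> where "\<rho> = min r r2"
    have \<rho>: "\<rho> > 0" "\<rho> \<le> r" "\<rho> \<le> r2" using V(1) r2(1) by (auto simp: \<rho>_def)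
    have "\<rho> ^ b \<in> {0..T}" using \<rho> r2(2) by (intro seg(1)) auto
    moreover have "summable (\<lambda>k. Re (d (m + k - m)) * t powr (real (m + k) / real b)) \<and>
        y t = taylor_initial \<alpha> y0 t + (\<Sum>k. Re (d (m + k - m)) * t powr (real (m + k) / real b))"
      if t: "t \<in> {0..<\<rho> ^ b}" for t
    proof -
      define x where "x = t powr (1 / real b)"
      have x: "x \<ge> 0" "x ^ b = t" using t b by (auto simp: x_def intro: powr_inverse_power)
      have "x < \<rho>" using x t \<rho>(1) by (intro power_less_imp_less_base[of x b \<rho>]) auto
      have pw: "t powr (real (m + k) / real b) = x ^ m * x ^ k" for k
        unfolding x(2)[symmetric] power_add[symmetric] using x(1) m1 b by (intro power_powr_eq) auto
      have "(\<lambda>k. of_real (x ^ m) * (d k * of_real x ^ k)) sums (of_real (x ^ m) * V (of_real x))"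
        using x(1) \<open>x < \<rho>\<close> \<rho>(2) by (intro sums_mult d) simp
      \<comment> \<open>On the real segment x^m V(x) equals the real number y(t) - \<psi>(t), so
        real parts of the coefficients suffice without showing that \<open>d\<close> is
        real.\<close>
      from sums_Re[OF this]
      have "(\<lambda>k. Re (d (m + k - m)) * t powr (real (m + k) / real b)) sums Re (of_real (x ^ m) * V (of_real x))"
        unfolding pw by (simp add: mult_ac flip: of_real_power)
      also have "of_real (x ^ m) * V (of_real x) = of_real (y t - taylor_initial \<alpha> y0 t)"
      proof -
        have "U (of_real x) = poly P (of_real x) + of_real x ^ m * V (of_real x)"
          using x(1) \<open>x < \<rho>\<close> \<rho>(3) by (intro bspec[OF r2(3)]) auto
        thus ?thesis by (simp add: U P x(2) algebra_simps)
      qed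
      finally have s: "(\<lambda>k. Re (d (m + k - m)) * t powr (real (m + k) / real b)) sums (y t - taylor_initial \<alpha> y0 t)"
        by (simp only: Re_complex_of_real)
      show ?thesis using sums_summable[OF s] sums_unique[OF s] by linarith
    qed
    ultimately show "\<exists>\<omega>. 0 < \<omega> \<and> \<omega> \<le> T \<and> (\<forall>t\<in>{0..<\<omega>}.
        summable (\<lambda>k. Re (d (m + k - m)) * t powr (real (m + k) / real b)) \<and>
        y t = taylor_initial \<alpha> y0 t + (\<Sum>k. Re (d (m + k - m)) * t powr (real (m + k) / real b)))"
      using \<rho>(1) by (intro exI[of _ "\<rho> ^ b"]) auto
  qed
qed

end
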